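(* In the setting of the context, assume that $\sum_{k\ge 0}\|\mathbb{E}(X_k\mid\mathcal{F}_0)\|_2^2<\infty$. Then the following statements are equivalent: 1. The $\mathbb{L}^2$-MA property holds. 2. The series $\sum_{k=0}^\infty P_0(X_k)$ converges in $\mathbb{L}^2$. 3. $\displaystyle \lim_{N\to\infty}\ \sup_{n\ge N}\ \frac1n\sum_{k=1}^n \mathbb{E}\big(X_0\,\mathbb{E}(S_{k-1}\mid\mathcal{F}_{-N})\big)=0.$ Moreover, if the $\mathbb{L}^2$-MA property holds, then the random variable $D$ in that property is $D=\sum_{k=0}^\infty P_0(X_k)$ (convergence in $\mathbb{L}^2$).
   Context: Let $(\Omega,\mathcal{A},\mathbb{P})$ be a probability space and $T:\Omega\to\Omega$ a bijective bimeasurable transformation preserving $\mathbb{P}$. Let $\mathcal{F}_0\subseteq\mathcal{A}$ be a $\sigma$-algebra with $\mathcal{F}_0\subseteq T^{-1}(\mathcal{F}_0)$, and let $\mathcal{F}_i=T^{-i}(\mathcal{F}_0)$ for $i\in\mathbb{Z}$. Let $X_0$ be an $\mathcal{F}_0$-measurable, square integrable, centered real random variable, $X_i=X_0\circ T^i$ for $i\in\mathbb{Z}$, and $S_n=X_1+\cdots+X_n$ (with $S_0=0$). Write $\|\cdot\|_2$ for the norm of $\mathbb{L}^2(\mathbb{P})$ and $P_0(X_k)=\mathbb{E}(X_k\mid\mathcal{F}_0)-\mathbb{E}(X_k\mid\mathcal{F}_{-1})$. The $\mathbb{L}^2$-MA property (martingale approximation in $\mathbb{L}^2$) means: there exists a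 (necessarily unique) $\mathcal{F}_0$-measurable random variable $D\in\mathbb{L}^2$ such that $\mathbb{E}(D\circ T\mid\mathcal{F}_0)=0$ a.s. and $\lim_{n\to\infty}\frac1n\big\|S_n-\sum_{k=1}^nD\circ T^k\big\|_2^2=0$. *)

theory Defs
  imports "HOL-Probability.Probability"
begin

text \<open>Integer iterates of a bijection of \<open>space M\<close>; only the values on \<open>space M\<close> matter.\<close>

definition int_iter :: "'a measure \<Rightarrow> ('a \<Rightarrow> 'a) \<Rightarrow> int \<Rightarrow> 'a \<Rightarrow> 'a" where
  "int_iter M T i =
     (if 0 \<le> i then T ^^ nat i else (inv_into (space M) T) ^^ nat (- i))"

definition bimeasurable_preserving :: "'a measure \<Rightarrow> ('a \<Rightarrow> 'a) \<Rightarrow> bool" where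
  "bimeasurable_preserving M T \<longleftrightarrow>
     bij_betw T (space M) (space M) \<and>
     T \<in> measurable M M \<and> inv_into (space M) T \<in> measurable M M \<and>
     distr M M T = M"

text \<open>\<open>filt M T F0 i\<close> is \<open>T\<^sup>-\<^sup>i(F0)\<close>, the preimage of \<open>F0\<close> under the \<open>i\<close>-th iterate.
  Sub-\<open>\<sigma>\<close>-algebras are represented by measures; only their \<open>space\<close> and \<open>sets\<close> are
  relevant.\<close>

definition filt :: "'a measure \<Rightarrow> ('a \<Rightarrow> 'a) \<Rightarrow> 'a measure \<Rightarrow> int \<Rightarrow> 'a measure" where
  "filt M T F0 i = vimage_algebra (space M) (int_iter M T i) F0"

definition X_seq :: "'a measure \<Rightarrow> ('a \<Rightarrow> 'a) \<Rightarrow> ('a \<Rightarrow> real) \<Rightarrow> int \<Rightarrow> 'a \<Rightarrow> real" where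
  "X_seq M T X0 i = (\<lambda>\<omega>. X0 (int_iter M T i \<omega>))"

definition S_sum :: "'a measure \<Rightarrow> ('a \<Rightarrow> 'a) \<Rightarrow> ('a \<Rightarrow> real) \<Rightarrow> nat \<Rightarrow> 'a \<Rightarrow> real" where
  "S_sum M T X0 n = (\<lambda>\<omega>. \<Sum>i=1..n. X_seq M T X0 (int i) \<omega>)"

definition P0 :: "'a measure \<Rightarrow> ('a \<Rightarrow> 'a) \<Rightarrow> 'a measure \<Rightarrow> ('a \<Rightarrow> real) \<Rightarrow> 'a \<Rightarrow> real" where
  "P0 M T F0 f = (\<lambda>\<omega>. real_cond_exp M F0 f \<omega> - real_cond_exp M (filt M T F0 (- 1)) f \<omega>)"

definition square_integrable :: "'a measure \<Rightarrow> ('a \<Rightarrow> real) \<Rightarrow> bool" where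
  "square_integrable M f \<longleftrightarrow> f \<in> borel_measurable M \<and> integrable M (\<lambda>\<omega>. (f \<omega>)\<^sup>2)"

text \<open>Meaningful for square integrable \<open>f\<close> only: otherwise the Bochner integral is \<open>0\<close>.\<close>

definition l2norm :: "'a measure \<Rightarrow> ('a \<Rightarrow> real) \<Rightarrow> real" where
  "l2norm M f = sqrt (\<integral>\<omega>. (f \<omega>)\<^sup>2 \<partial>M)"

definition L2_sums :: "'a measure \<Rightarrow> (nat \<Rightarrow> 'a \<Rightarrow> real) \<Rightarrow> ('a \<Rightarrow> real) \<Rightarrow> bool" where
  "L2_sums M f Y \<longleftrightarrow>
     (\<forall>k. square_integrable M (f k)) \<and> square_integrable M Y \<and>
     (\<lambda>n. l2norm M (\<lambda>\<omega>. (\<Sum>k<n. f k \<omega>) - Y \<omega>)) \<longlonglongrightarrow> 0"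

definition L2_MA_with ::
    "'a measure \<Rightarrow> ('a \<Rightarrow> 'a) \<Rightarrow> 'a measure \<Rightarrow> ('a \<Rightarrow> real) \<Rightarrow> ('a \<Rightarrow> real) \<Rightarrow> bool" where
  "L2_MA_with M T F0 X0 D \<longleftrightarrow>
     D \<in> borel_measurable F0 \<and> square_integrable M D \<and>
     (AE \<omega> in M. real_cond_exp M F0 (\<lambda>\<omega>. D (T \<omega>)) \<omega> = 0) \<and>
     (\<lambda>n. (1 / real n) *
        (l2norm M (\<lambda>\<omega>. S_sum M T X0 n \<omega> - (\<Sum>k=1..n. D ((T ^^ k) \<omega>))))\<^sup>2) \<longlonglongrightarrow> 0"

definition L2_MA ::
    "'a measure \<Rightarrow> ('a \<Rightarrow> 'a) \<Rightarrow> 'a measure \<Rightarrow> ('a \<Rightarrow> real) \<Rightarrow> bool" where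
  "L2_MA M T F0 X0 \<longleftrightarrow> (\<exists>D. L2_MA_with M T F0 X0 D)"

end

theory Submission
  imports Defs
begin

text \<open>
  Write \<open>U f = f \<circ> T\<close>, \<open>E\<^sub>n\<close> for the projection of \<open>L\<^sup>2\<close> onto the functions measurable with respect
  to \<open>T\<^sup>n(\<F>\<^sub>0) = \<F>\<^sub>-\<^sub>n\<close>, \<open>P = E\<^sub>0 - E\<^sub>1\<close>, \<open>x = X\<^sub>0\<close> and \<open>D\<^sub>n = \<Sum>k<n. P (U\<^sup>k x)\<close>. Everything follows from
  one Pythagorean identity (\<open>martingale_decomposition\<close>): for \<open>w\<close> measurable with respect to \<open>\<F>\<^sub>0\<close> and
  \<open>S\<^sub>n w = \<Sum>k=1..n. U\<^sup>k w\<close>,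
  \<open>\<parallel>S\<^sub>n w\<parallel>\<^sup>2 = \<parallel>E\<^sub>0 S\<^sub>n w\<parallel>\<^sup>2 + (\<Sum>j=1..n. \<parallel>P (\<Sum>k<j. U\<^sup>k w)\<parallel>\<^sup>2)\<close>.
  It is used for two choices of \<open>w\<close>. If \<open>w = x - D\<close>, where \<open>D \<circ> T\<close> is a martingale difference, the
  \<open>j\<close>-th summand is \<open>\<parallel>D\<^sub>j - D\<parallel>\<^sup>2\<close>. If \<open>w = E\<^sub>N x\<close>, it is \<open>\<parallel>D\<^sub>j - D\<^sub>N\<parallel>\<^sup>2\<close> for \<open>j \<ge> N\<close> and \<open>0\<close> before. In both
  cases \<open>\<parallel>E\<^sub>0 S\<^sub>n w\<parallel>\<close> is at most \<open>\<Sum>k=1..n. \<parallel>E\<^sub>k x\<parallel>\<close>, and the square of this is \<open>o(n)\<close> by Cauchy--Schwarz,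
  since \<open>\<parallel>E\<^sub>k x\<parallel>\<^sup>2 = \<parallel>\<E>(X\<^sub>k | \<F>\<^sub>0)\<parallel>\<^sup>2\<close> is summable.

  Hence \<open>D\<close> yields a martingale approximation iff \<open>\<parallel>D\<^sub>j - D\<parallel>\<^sup>2\<close> tends to \<open>0\<close> in the sense of Cesaro.
  This is the same as \<open>D\<^sub>j \<rightarrow> D\<close>, because the sequence oscillates slowly: for \<open>m \<le> j \<le> 2m\<close>,
  \<open>\<parallel>D\<^sub>j - D\<^sub>m\<parallel>\<^sup>2 \<le> m (\<Sum>k\<ge>m. \<parallel>P (U\<^sup>k x)\<parallel>\<^sup>2) \<le> m \<parallel>E\<^sub>m x\<parallel>\<^sup>2\<close>,
  and \<open>m \<parallel>E\<^sub>m x\<parallel>\<^sup>2 \<rightarrow> 0\<close> since \<open>\<parallel>E\<^sub>m x\<parallel>\<^sup>2\<close> is decreasing and summable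
  (\<open>innovation_sum_oscillation\<close>, \<open>average_imp_convergence\<close>).

  For the covariance condition put \<open>y = E\<^sub>N x\<close>. The numbers \<open>\<E>(X\<^sub>0 \<E>(X\<^sub>i | \<F>\<^sub>-\<^sub>N))\<close> are the autocovariances
  \<open>\<langle>y, U\<^sup>i y\<rangle>\<close>, whose sums build up \<open>\<parallel>S\<^sub>n y\<parallel>\<^sup>2\<close>; so twice the expression in that condition is
  \<open>\<parallel>S\<^sub>n y\<parallel>\<^sup>2 / n - \<parallel>y\<parallel>\<^sup>2\<close>. By the identity above, it is small uniformly in \<open>n \<ge> N\<close> iff the averages of
  \<open>\<parallel>D\<^sub>j - D\<^sub>N\<parallel>\<^sup>2\<close> are, and by slow oscillation iff \<open>(D\<^sub>n)\<close> is a Cauchy sequence. Completeness of \<open>L\<^sup>2\<close>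
  closes the circle (\<open>mean_covariance_imp_convergence\<close>, \<open>convergence_imp_mean_covariance\<close>).
\<close>

section \<open>The space of square integrable functions\<close>

definition l2inner :: "'a measure \<Rightarrow> ('a \<Rightarrow> real) \<Rightarrow> ('a \<Rightarrow> real) \<Rightarrow> real" where
  "l2inner M f g = (\<integral>\<omega>. f \<omega> * g \<omega> \<partial>M)"

lemma square_integrable_measurable [measurable_dest]:
  "square_integrable M f \<Longrightarrow> f \<in> borel_measurable M"
  by (simp add: square_integrable_def)

lemma square_integrable_mult_integrable:
  assumes "square_integrable M f" "square_integrable M g"
  shows "integrable M (\<lambda>\<omega>. f \<omega> * g \<omega>)"
proof (rule Bochner_Integration.integrable_bound)
  show "integrable M (\<lambda>\<omega>. (f \<omega>)\<^sup>2 + (g \<omega>)\<^sup>2)"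
    using assms by (simp add: square_integrable_def)
  show "(\<lambda>\<omega>. f \<omega> * g \<omega>) \<in> borel_measurable M"
    using assms by (auto dest!: square_integrable_measurable)
  have "\<bar>a * b\<bar> \<le> a\<^sup>2 + b\<^sup>2" for a b :: real
  proof -
    have "2 * (\<bar>a\<bar> * \<bar>b\<bar>) \<le> a\<^sup>2 + b\<^sup>2"
      using sum_squares_bound[of "\<bar>a\<bar>" "\<bar>b\<bar>"] by simp
    moreover have "0 \<le> \<bar>a\<bar> * \<bar>b\<bar>" by simp
    ultimately show ?thesis unfolding abs_mult by linarith
  qed
  then show "AE \<omega> in M. norm (f \<omega> * g \<omega>) \<le> norm ((f \<omega>)\<^sup>2 + (g \<omega>)\<^sup>2)"
    by simp
qed

lemma square_integrable_scale [simp]: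
  "square_integrable M f \<Longrightarrow> square_integrable M (\<lambda>\<omega>. c * f \<omega>)"
  by (auto simp: square_integrable_def power_mult_distrib)

lemma square_integrable_zero [simp]: "square_integrable M (\<lambda>\<omega>. 0)"
  by (simp add: square_integrable_def)

lemma square_integrable_add [simp]:
  assumes "square_integrable M f" "square_integrable M g"
  shows "square_integrable M (\<lambda>\<omega>. f \<omega> + g \<omega>)"
proof -
  have "integrable M (\<lambda>\<omega>. (f \<omega>)\<^sup>2 + 2 * (f \<omega> * g \<omega>) + (g \<omega>)\<^sup>2)"
    using assms square_integrable_mult_integrable[OF assms]
    by (simp add: square_integrable_def)
  then show ?thesis
    using assms by (auto simp: square_integrable_def power2_sum algebra_simps)
qed

lemma square_integrable_diff [simp]:
  assumes "square_integrable M f" "square_integrable M g"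
  shows "square_integrable M (\<lambda>\<omega>. f \<omega> - g \<omega>)"
  using square_integrable_add[OF assms(1) square_integrable_scale[OF assms(2), of "-1"]] by simp

lemma square_integrable_sum [simp]:
  "(\<And>i. i \<in> I \<Longrightarrow> square_integrable M (f i)) \<Longrightarrow> square_integrable M (\<lambda>\<omega>. \<Sum>i\<in>I. f i \<omega>)"
  by (induction I rule: infinite_finite_induct) simp_all

lemma l2norm_nonneg [simp]: "0 \<le> l2norm M f"
  by (simp add: l2norm_def)

lemma l2norm_power2: "(l2norm M f)\<^sup>2 = l2inner M f f"
  by (simp add: l2norm_def l2inner_def power2_eq_square)

lemma l2inner_commute: "l2inner M f g = l2inner M g f"
  by (simp add: l2inner_def mult.commute)

lemma l2inner_diff_left:
  assumes "square_integrable M f" "square_integrable M g" "square_integrable M h"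
  shows "l2inner M (\<lambda>\<omega>. f \<omega> - g \<omega>) h = l2inner M f h - l2inner M g h"
  using square_integrable_mult_integrable[OF assms(1,3)]
    square_integrable_mult_integrable[OF assms(2,3)]
  by (simp add: l2inner_def left_diff_distrib)

lemma l2inner_scale_left: "l2inner M (\<lambda>\<omega>. c * f \<omega>) h = c * l2inner M f h"
  by (simp add: l2inner_def mult.assoc)

lemma l2norm_scale: "l2norm M (\<lambda>\<omega>. c * f \<omega>) = \<bar>c\<bar> * l2norm M f"
  by (simp add: l2norm_def power_mult_distrib real_sqrt_mult)

lemma l2norm_power2_diff:
  assumes "square_integrable M f" "square_integrable M g"
  shows "(l2norm M (\<lambda>\<omega>. f \<omega> - g \<omega>))\<^sup>2
    = (l2norm M f)\<^sup>2 - 2 * l2inner M f g + (l2norm M g)\<^sup>2"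
proof -
  have s: "square_integrable M (\<lambda>\<omega>. f \<omega> - g \<omega>)"
    using assms by simp
  show ?thesis
    unfolding l2norm_power2 l2inner_diff_left[OF assms s]
      l2inner_commute[of M _ "\<lambda>\<omega>. f \<omega> - g \<omega>"]
    using l2inner_diff_left[OF assms assms(1)] l2inner_diff_left[OF assms assms(2)]
      l2inner_commute[of M g f] by simp
qed

lemma l2norm_power2_add:
  assumes "square_integrable M f" "square_integrable M g"
  shows "(l2norm M (\<lambda>\<omega>. f \<omega> + g \<omega>))\<^sup>2
    = (l2norm M f)\<^sup>2 + 2 * l2inner M f g + (l2norm M g)\<^sup>2"
  using l2norm_power2_diff[OF assms(1) square_integrable_scale[OF assms(2), of "-1"]]
    l2inner_scale_left[of M "-1" g f] l2norm_scale[of M "-1" g]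
  by (simp add: l2inner_commute)

lemma l2norm_cong_AE:
  assumes "AE \<omega> in M. f \<omega> = g \<omega>" "square_integrable M f" "square_integrable M g"
  shows "l2norm M f = l2norm M g"
proof -
  have [measurable]: "f \<in> borel_measurable M" "g \<in> borel_measurable M"
    using assms(2,3) by (auto dest: square_integrable_measurable)
  show ?thesis
    unfolding l2norm_def using assms(1)
    by (intro arg_cong[where f = sqrt] integral_cong_AE) auto
qed

lemma l2inner_cong_AE:
  assumes "AE \<omega> in M. f \<omega> = g \<omega>" "square_integrable M f" "square_integrable M g"
    "square_integrable M h"
  shows "l2inner M f h = l2inner M g h"
proof -
  have "AE \<omega> in M. f \<omega> * h \<omega> = g \<omega> * h \<omega>" using assms(1) by eventually_elim simp
  then show ?thesis
    unfolding l2inner_def using assms(2-4)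
    by (intro integral_cong_AE borel_measurable_times square_integrable_measurable)
qed

lemma l2norm_eq_0_iff:
  assumes "square_integrable M f"
  shows "l2norm M f = 0 \<longleftrightarrow> (AE \<omega> in M. f \<omega> = 0)"
proof -
  have "integrable M (\<lambda>\<omega>. (f \<omega>)\<^sup>2)"
    using assms by (simp add: square_integrable_def)
  from integral_nonneg_eq_0_iff_AE[OF this] show ?thesis
    by (simp add: l2norm_def)
qed

lemma l2norm_zero [simp]: "l2norm M (\<lambda>\<omega>. 0) = 0"
  by (simp add: l2norm_def)

lemma l2inner_Cauchy_Schwarz:
  assumes f: "square_integrable M f" and g: "square_integrable M g"
  shows "l2inner M f g \<le> l2norm M f * l2norm M g"
proof (cases "l2norm M g = 0")
  case True
  then have "AE \<omega> in M. g \<omega> = 0" using l2norm_eq_0_iff[OF g] by simp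
  then have "AE \<omega> in M. f \<omega> * g \<omega> = 0" by eventually_elim simp
  then have "l2inner M f g = 0" unfolding l2inner_def by (rule integral_eq_zero_AE)
  then show ?thesis using True by simp
next
  case False
  \<comment> \<open>the factor that equates the norms of \<open>f\<close> and \<open>t * g\<close>\<close>
  define t where "t = l2norm M f / l2norm M g"
  show ?thesis
  proof (cases "l2norm M f = 0")
    case True
    then have "AE \<omega> in M. f \<omega> = 0" using l2norm_eq_0_iff[OF f] by simp
    then have "AE \<omega> in M. f \<omega> * g \<omega> = 0" by eventually_elim simp
    then have "l2inner M f g = 0" unfolding l2inner_def by (rule integral_eq_zero_AE)
    then show ?thesis using True by simp
  next
    case f0: False
    have t: "t > 0" using False f0 l2norm_nonneg[of M f] l2norm_nonneg[of M g]
      by (simp add: t_def less_le)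
    have "0 \<le> (l2norm M (\<lambda>\<omega>. f \<omega> - t * g \<omega>))\<^sup>2" by simp
    also have "\<dots> = (l2norm M f)\<^sup>2 - 2 * (t * l2inner M f g) + (t * l2norm M g)\<^sup>2"
      using l2norm_power2_diff[OF f square_integrable_scale[OF g, of t]] t
        l2inner_scale_left[of M t g f]
      by (simp add: l2norm_scale l2inner_commute)
    also have "t * l2norm M g = l2norm M f" using False by (simp add: t_def)
    finally have "t * l2inner M f g \<le> (l2norm M f)\<^sup>2" by simp
    also have "\<dots> = t * (l2norm M f * l2norm M g)"
      using False by (simp add: t_def power2_eq_square)
    finally show ?thesis using t by simp
  qed
qed

lemma l2norm_triangle:
  assumes "square_integrable M f" "square_integrable M g"
  shows "l2norm M (\<lambda>\<omega>. f \<omega> + g \<omega>) \<le> l2norm M f + l2norm M g"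
proof (rule power2_le_imp_le)
  show "(l2norm M (\<lambda>\<omega>. f \<omega> + g \<omega>))\<^sup>2 \<le> (l2norm M f + l2norm M g)\<^sup>2"
    using l2norm_power2_add[OF assms] l2inner_Cauchy_Schwarz[OF assms]
    by (simp add: power2_sum)
qed simp

lemma l2norm_minus_commute: "l2norm M (\<lambda>\<omega>. f \<omega> - g \<omega>) = l2norm M (\<lambda>\<omega>. g \<omega> - f \<omega>)"
  by (simp add: l2norm_def power2_commute)

lemma l2norm_triangle_diff:
  assumes "square_integrable M f" "square_integrable M g" "square_integrable M h"
  shows "l2norm M (\<lambda>\<omega>. f \<omega> - h \<omega>)
    \<le> l2norm M (\<lambda>\<omega>. f \<omega> - g \<omega>) + l2norm M (\<lambda>\<omega>. g \<omega> - h \<omega>)"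
  using l2norm_triangle[of M "\<lambda>\<omega>. f \<omega> - g \<omega>" "\<lambda>\<omega>. g \<omega> - h \<omega>"] assms by simp

lemma l2norm_sum_le:
  "(\<And>i. i \<in> I \<Longrightarrow> square_integrable M (f i)) \<Longrightarrow>
    l2norm M (\<lambda>\<omega>. \<Sum>i\<in>I. f i \<omega>) \<le> (\<Sum>i\<in>I. l2norm M (f i))"
proof (induction I rule: infinite_finite_induct)
  case (insert i I)
  have "l2norm M (\<lambda>\<omega>. f i \<omega> + (\<Sum>i\<in>I. f i \<omega>))
      \<le> l2norm M (f i) + l2norm M (\<lambda>\<omega>. \<Sum>i\<in>I. f i \<omega>)"
    using insert.prems by (intro l2norm_triangle) auto
  moreover have "l2norm M (\<lambda>\<omega>. \<Sum>i\<in>I. f i \<omega>) \<le> (\<Sum>i\<in>I. l2norm M (f i))"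
    using insert by auto
  ultimately show ?case using insert by simp
qed simp_all

lemma (in prob_space) square_integrable_integrable:
  "square_integrable M f \<Longrightarrow> integrable M f"
  unfolding square_integrable_def by (rule square_integrable_imp_integrable) auto

lemma (in prob_space) integral_abs_le_l2norm:
  assumes "square_integrable M f"
  shows "(\<integral>\<omega>. \<bar>f \<omega>\<bar> \<partial>M) \<le> l2norm M f"
proof -
  have "square_integrable M (\<lambda>\<omega>. \<bar>f \<omega>\<bar>)" "square_integrable M (\<lambda>\<omega>. 1)"
    using assms by (auto simp: square_integrable_def)
  from l2inner_Cauchy_Schwarz[OF this] show ?thesis
    by (simp add: l2inner_def l2norm_def prob_space)
qed

text \<open>
  Riesz--Fischer. A subsequence whose consecutive distances are at most \<open>2\<^sup>-\<^sup>k\<close> has almost surely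
  summable increments, because \<open>L\<^sup>1\<close> norms are dominated by \<open>L\<^sup>2\<close> norms; Fatou's lemma then
  shows that its pointwise limit is the \<open>L\<^sup>2\<close> limit of the whole sequence.
\<close>

lemma (in prob_space) l2_complete:
  fixes D :: "nat \<Rightarrow> 'a \<Rightarrow> real"
  assumes sq: "\<And>n. square_integrable M (D n)"
    and Cauchy: "\<And>e. e > 0 \<Longrightarrow> \<exists>N. \<forall>m\<ge>N. \<forall>n\<ge>N. l2norm M (\<lambda>\<omega>. D m \<omega> - D n \<omega>) < e"
  shows "\<exists>Y. square_integrable M Y \<and> (\<lambda>n. l2norm M (\<lambda>\<omega>. D n \<omega> - Y \<omega>)) \<longlonglongrightarrow> 0"
proof -
  have [measurable]: "D n \<in> borel_measurable M" for n
    using sq by (rule square_integrable_measurable)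
  have "\<forall>k. \<exists>N. \<forall>m\<ge>N. \<forall>n\<ge>N. l2norm M (\<lambda>\<omega>. D m \<omega> - D n \<omega>) < (1/2)^k"
    using Cauchy by simp
  then obtain R where R: "\<And>k m n. m \<ge> R k \<Longrightarrow> n \<ge> R k \<Longrightarrow>
      l2norm M (\<lambda>\<omega>. D m \<omega> - D n \<omega>) < (1/2)^k"
    by metis
  \<comment> \<open>a monotone majorant of \<open>R\<close>\<close>
  define r where "r k = k + (\<Sum>i\<le>k. R i)" for k
  have r_ge: "R k \<le> r k" for k
    unfolding r_def by (simp add: member_le_sum trans_le_add2)
  have r_Suc: "r k \<le> r (Suc k)" for k
    by (simp add: r_def)
  define u where "u k = D (r k)" for k
  have [measurable]: "u k \<in> borel_measurable M" for k by (simp add: u_def)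
  have usq: "square_integrable M (u k)" for k by (simp add: u_def sq)
  have u_step: "l2norm M (\<lambda>\<omega>. u (Suc k) \<omega> - u k \<omega>) \<le> (1/2)^k" for k
    using R[of k "r (Suc k)" "r k"] r_ge[of k] r_Suc[of k] by (simp add: u_def)
  have "(\<integral>\<^sup>+\<omega>. (\<Sum>k. ennreal \<bar>u (Suc k) \<omega> - u k \<omega>\<bar>) \<partial>M)
      = (\<Sum>k. \<integral>\<^sup>+\<omega>. ennreal \<bar>u (Suc k) \<omega> - u k \<omega>\<bar> \<partial>M)"
    by (rule nn_integral_suminf) simp
  also have "\<dots> \<le> (\<Sum>k. ennreal ((1/2)^k))"
  proof (rule suminf_le)
    fix k
    have s: "square_integrable M (\<lambda>\<omega>. u (Suc k) \<omega> - u k \<omega>)" by (simp add: usq)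
    have "(\<integral>\<^sup>+\<omega>. ennreal \<bar>u (Suc k) \<omega> - u k \<omega>\<bar> \<partial>M) = ennreal (\<integral>\<omega>. \<bar>u (Suc k) \<omega> - u k \<omega>\<bar> \<partial>M)"
      by (rule nn_integral_eq_integral) (use square_integrable_integrable[OF s] in auto)
    also have "\<dots> \<le> ennreal ((1/2)^k)"
      using integral_abs_le_l2norm[OF s] u_step[of k] by (intro ennreal_leI) simp
    finally show "(\<integral>\<^sup>+\<omega>. ennreal \<bar>u (Suc k) \<omega> - u k \<omega>\<bar> \<partial>M) \<le> ennreal ((1/2)^k)" .
  qed auto
  also have "\<dots> = ennreal (\<Sum>k. (1/2)^k)"
    by (rule suminf_ennreal2) (auto intro: summable_geometric)
  also have "\<dots> < \<infinity>" by simp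
  finally have "(\<integral>\<^sup>+\<omega>. (\<Sum>k. ennreal \<bar>u (Suc k) \<omega> - u k \<omega>\<bar>) \<partial>M) \<noteq> \<infinity>" by simp
  then have "AE \<omega> in M. (\<Sum>k. ennreal \<bar>u (Suc k) \<omega> - u k \<omega>\<bar>) \<noteq> \<infinity>"
    by (intro nn_integral_noteq_infinite) auto
  then have conv: "AE \<omega> in M. convergent (\<lambda>k. u k \<omega>)"
  proof eventually_elim
    case (elim \<omega>)
    then have "summable (\<lambda>k. \<bar>u (Suc k) \<omega> - u k \<omega>\<bar>)"
      by (intro summable_suminf_not_top) auto
    then have "summable (\<lambda>k. u (Suc k) \<omega> - u k \<omega>)"
      by (rule summable_rabs_cancel)
    then have "convergent (\<lambda>n. (u n \<omega> - u 0 \<omega>) + u 0 \<omega>)"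
      unfolding summable_iff_convergent sum_lessThan_telescope[of "\<lambda>k. u k \<omega>"]
      by (rule convergent_add) (rule convergent_const)
    then show ?case by simp
  qed
  define Y where "Y \<omega> = lim (\<lambda>k. u k \<omega>)" for \<omega>
  have [measurable]: "Y \<in> borel_measurable M"
    unfolding Y_def by measurable
  have lim: "AE \<omega> in M. (\<lambda>k. u k \<omega>) \<longlonglongrightarrow> Y \<omega>"
    using conv by eventually_elim (simp add: Y_def convergent_LIMSEQ_iff)
  have bound: "(\<integral>\<^sup>+\<omega>. ennreal ((D n \<omega> - Y \<omega>)\<^sup>2) \<partial>M) \<le> ennreal (((1/2)^k)\<^sup>2)" if n: "n \<ge> R k" for n k
  proof -
    have "(\<integral>\<^sup>+\<omega>. ennreal ((D n \<omega> - Y \<omega>)\<^sup>2) \<partial>M)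
        = (\<integral>\<^sup>+\<omega>. liminf (\<lambda>i. ennreal ((D n \<omega> - u i \<omega>)\<^sup>2)) \<partial>M)"
    proof (rule nn_integral_cong_AE)
      show "AE \<omega> in M. ennreal ((D n \<omega> - Y \<omega>)\<^sup>2) = liminf (\<lambda>i. ennreal ((D n \<omega> - u i \<omega>)\<^sup>2))"
        using lim
      proof eventually_elim
        case (elim \<omega>)
        then have "(\<lambda>i. ennreal ((D n \<omega> - u i \<omega>)\<^sup>2)) \<longlonglongrightarrow> ennreal ((D n \<omega> - Y \<omega>)\<^sup>2)"
          by (intro tendsto_intros)
        from lim_imp_Liminf[OF sequentially_bot this] show ?case by simp
      qed
    qed
    also have "\<dots> \<le> liminf (\<lambda>i. \<integral>\<^sup>+\<omega>. ennreal ((D n \<omega> - u i \<omega>)\<^sup>2) \<partial>M)"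
      by (rule nn_integral_liminf) auto
    also have "\<dots> \<le> liminf (\<lambda>i. ennreal (((1/2)^k)\<^sup>2))"
    proof (rule Liminf_mono, rule eventually_sequentiallyI[of k])
      fix i assume "i \<ge> k"
      then have "r k \<le> r i" using r_Suc by (rule lift_Suc_mono_le[rotated])
      then have i: "r i \<ge> R k" using r_ge[of k] by simp
      have "square_integrable M (\<lambda>\<omega>. D n \<omega> - u i \<omega>)" by (simp add: sq usq)
      then have "(\<integral>\<^sup>+\<omega>. ennreal ((D n \<omega> - u i \<omega>)\<^sup>2) \<partial>M) = ennreal (\<integral>\<omega>. (D n \<omega> - u i \<omega>)\<^sup>2 \<partial>M)"
        by (intro nn_integral_eq_integral) (auto simp: square_integrable_def)
      also have "\<dots> = ennreal ((l2norm M (\<lambda>\<omega>. D n \<omega> - u i \<omega>))\<^sup>2)"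
        by (simp add: l2norm_def)
      also have "\<dots> \<le> ennreal (((1/2)^k)\<^sup>2)"
        using R[OF n i] by (intro ennreal_leI power_mono) (auto simp: u_def less_imp_le)
      finally show "(\<integral>\<^sup>+\<omega>. ennreal ((D n \<omega> - u i \<omega>)\<^sup>2) \<partial>M) \<le> ennreal (((1/2)^k)\<^sup>2)" .
    qed
    also have "\<dots> = ennreal (((1/2)^k)\<^sup>2)"
      by (simp add: Liminf_const)
    finally show ?thesis .
  qed
  have diffsq: "square_integrable M (\<lambda>\<omega>. D n \<omega> - Y \<omega>)" if "n \<ge> R k" for n k
  proof -
    have "integrable M (\<lambda>\<omega>. (D n \<omega> - Y \<omega>)\<^sup>2)"
      using bound[OF that]
      by (intro integrableI_bounded) (auto simp: top_unique less_top[symmetric] dest: le_less_trans)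
    then show ?thesis by (simp add: square_integrable_def)
  qed
  have Ysq: "square_integrable M Y"
    using square_integrable_diff[OF sq[of "R 0"] diffsq[of 0 "R 0"]] by simp
  have le: "l2norm M (\<lambda>\<omega>. D n \<omega> - Y \<omega>) \<le> (1/2)^k" if n: "n \<ge> R k" for n k
  proof -
    have "ennreal (\<integral>\<omega>. (D n \<omega> - Y \<omega>)\<^sup>2 \<partial>M) \<le> ennreal (((1/2)^k)\<^sup>2)"
      using bound[OF n] diffsq[OF n]
      by (subst nn_integral_eq_integral[symmetric]) (auto simp: square_integrable_def)
    then have "(\<integral>\<omega>. (D n \<omega> - Y \<omega>)\<^sup>2 \<partial>M) \<le> ((1/2)^k)\<^sup>2"
      by (subst (asm) ennreal_le_iff) auto
    then show ?thesis unfolding l2norm_def by (intro real_le_lsqrt) auto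
  qed
  have "(\<lambda>n. l2norm M (\<lambda>\<omega>. D n \<omega> - Y \<omega>)) \<longlonglongrightarrow> 0"
  proof (rule LIMSEQ_I)
    fix e :: real assume "e > 0"
    then obtain k where "(1/2)^k < e" using real_arch_pow_inv[of e "1/2"] by auto
    then show "\<exists>N. \<forall>n\<ge>N. norm (l2norm M (\<lambda>\<omega>. D n \<omega> - Y \<omega>) - 0) < e"
      using le[of k] by (intro exI[of _ "R k"]) (auto intro: le_less_trans)
  qed
  then show ?thesis using Ysq by blast
qed

section \<open>Averages, oscillation and suprema of real sequences\<close>

text \<open>
  The Tauberian step. Every \<open>e j\<close> with \<open>m \<le> j < 2 m\<close> is at least \<open>e m - s\<close>, so \<open>e m\<close> is controlled by an average
  over this dyadic block, and the block makes up half of \<open>{1..2 m}\<close>.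
\<close>

lemma power2_le_average_plus_oscillation:
  fixes e :: "nat \<Rightarrow> real"
  assumes m: "0 < m" and e: "\<And>j. 0 \<le> e j"
    and osc: "\<And>j. m \<le> j \<Longrightarrow> j \<le> 2 * m \<Longrightarrow> e m \<le> e j + s"
  shows "(e m)\<^sup>2 \<le> 4 * ((1 / real (2 * m)) * (\<Sum>j=m..2*m. (e j)\<^sup>2)) + 2 * s\<^sup>2"
proof -
  have sq: "(e m)\<^sup>2 \<le> 2 * (e j)\<^sup>2 + 2 * s\<^sup>2" if "m \<le> j" "j \<le> 2 * m" for j
  proof -
    have "(e m)\<^sup>2 \<le> (e j + s)\<^sup>2" using osc[OF that] e by (intro power_mono) auto
    also have "\<dots> \<le> 2 * (e j)\<^sup>2 + 2 * s\<^sup>2"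
      using sum_squares_bound[of "e j" s] by (simp add: power2_sum)
    finally show ?thesis .
  qed
  have "real m * (e m)\<^sup>2 = (\<Sum>j=m..<2*m. (e m)\<^sup>2)" by simp
  also have "\<dots> \<le> (\<Sum>j=m..<2*m. 2 * (e j)\<^sup>2 + 2 * s\<^sup>2)" by (intro sum_mono sq) auto
  also have "\<dots> = 2 * (\<Sum>j=m..<2*m. (e j)\<^sup>2) + real m * (2 * s\<^sup>2)"
    by (simp add: sum.distrib sum_distrib_left)
  also have "(\<Sum>j=m..<2*m. (e j)\<^sup>2) \<le> (\<Sum>j=m..2*m. (e j)\<^sup>2)"
    by (intro sum_mono2) auto
  finally have "real m * (e m)\<^sup>2 \<le> 2 * (\<Sum>j=m..2*m. (e j)\<^sup>2) + real m * (2 * s\<^sup>2)" by simp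
  then have "(e m)\<^sup>2 \<le> (2 * (\<Sum>j=m..2*m. (e j)\<^sup>2) + real m * (2 * s\<^sup>2)) / real m"
    using m by (simp add: pos_le_divide_eq mult.commute)
  also have "\<dots> = 4 * ((1 / real (2 * m)) * (\<Sum>j=m..2*m. (e j)\<^sup>2)) + 2 * s\<^sup>2"
    using m by (simp add: field_simps)
  finally show ?thesis .
qed

text \<open>
  The terms with index between \<open>m / 2\<close> and \<open>m\<close> are all at least \<open>a m\<close>, and their sum is a Cauchy
  remainder of the series.
\<close>

lemma summable_decseq_imp_mult_tendsto_0:
  fixes a :: "nat \<Rightarrow> real"
  assumes sum: "summable a" and nn: "\<And>k. 0 \<le> a k" and dec: "decseq a"
  shows "(\<lambda>m. real m * a m) \<longlonglongrightarrow> 0"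
proof (rule LIMSEQ_I)
  fix r :: real assume r: "0 < r"
  then obtain K where K: "\<And>m n. m \<ge> K \<Longrightarrow> norm (sum a {m..<n}) < r / 4"
    using sum unfolding summable_Cauchy by (metis zero_less_divide_iff zero_less_numeral)
  have "norm (real m * a m - 0) < r" if m: "m \<ge> 2 * K" for m
  proof -
    let ?h = "m div 2"
    have "real m * a m \<le> 2 * (real (card {?h..<Suc m}) * a m)"
      using nn[of m] by (simp add: mult.assoc[symmetric] mult_right_mono)
    also have "real (card {?h..<Suc m}) * a m \<le> sum a {?h..<Suc m}"
      using sum_bounded_below[of "{?h..<Suc m}" "a m" a] decseqD[OF dec] by auto
    also have "\<dots> \<le> norm (sum a {?h..<Suc m})" by simp
    also have "\<dots> < r / 4" using m by (intro K) auto
    finally have "real m * a m < r" using r by simp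
    then show ?thesis using nn[of m] by simp
  qed
  then show "\<exists>no. \<forall>n\<ge>no. norm (real n * a n - 0) < r" by blast
qed

text \<open>
  Cauchy--Schwarz on all of \<open>{1..n}\<close> only gives boundedness. Applied beyond a fixed index \<open>L\<close> it gives
  an arbitrarily small bound, while the first \<open>L\<close> terms contribute a constant, divided by \<open>n\<close>.
\<close>

lemma summable_power2_imp_average_tendsto_0:
  fixes b :: "nat \<Rightarrow> real"
  assumes sum: "summable (\<lambda>k. (b k)\<^sup>2)" and nn: "\<And>k. 0 \<le> b k"
  shows "(\<lambda>n. (1 / real n) * (\<Sum>k=1..n. b k)\<^sup>2) \<longlonglongrightarrow> 0"
proof (rule LIMSEQ_I)
  fix r :: real assume r: "0 < r"
  then obtain K where K: "\<And>m n. m \<ge> K \<Longrightarrow> norm (sum (\<lambda>k. (b k)\<^sup>2) {m..<n}) < r / 4"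
    using sum unfolding summable_Cauchy by (metis zero_less_divide_iff zero_less_numeral)
  \<comment> \<open>starting beyond \<open>0\<close> leaves at most \<open>n\<close> indices in \<open>{L..<Suc n}\<close>\<close>
  define L where "L = Suc K"
  define C where "C = (\<Sum>k<L. b k)"
  have "(\<lambda>n. (2 * C\<^sup>2) * (1 / real n)) \<longlonglongrightarrow> (2 * C\<^sup>2) * 0"
    by (intro tendsto_mult tendsto_const lim_1_over_n)
  from LIMSEQ_D[OF this, of "r / 2"] r obtain N where
    N: "\<And>n. n \<ge> N \<Longrightarrow> \<bar>(2 * C\<^sup>2) * (1 / real n)\<bar> < r / 2" by auto
  have "norm ((1 / real n) * (\<Sum>k=1..n. b k)\<^sup>2 - 0) < r" if n: "n \<ge> max N 1" for n
  proof -
    let ?R = "\<Sum>k\<in>{L..<Suc n}. b k"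
    have C: "0 \<le> C" unfolding C_def by (intro sum_nonneg nn)
    have R: "0 \<le> ?R" by (intro sum_nonneg nn)
    have "(\<Sum>k=1..n. b k) \<le> (\<Sum>k\<in>{..<L} \<union> {L..<Suc n}. b k)"
      by (intro sum_mono2) (auto simp: nn)
    also have "\<dots> = C + ?R" unfolding C_def by (intro sum.union_disjoint) auto
    finally have "(\<Sum>k=1..n. b k)\<^sup>2 \<le> (C + ?R)\<^sup>2"
      by (intro power_mono sum_nonneg nn)
    also have "\<dots> \<le> 2 * C\<^sup>2 + 2 * ?R\<^sup>2"
      using sum_squares_bound[of C ?R] by (simp add: power2_sum)
    also have "?R\<^sup>2 \<le> (\<Sum>k\<in>{L..<Suc n}. (b k)\<^sup>2) * real (card {L..<Suc n})"
      by (rule sum_squared_le_sum_of_squares)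
    also have "\<dots> \<le> r / 4 * real n"
      using K[of L "Suc n"] r by (intro mult_mono) (auto simp: L_def intro: less_imp_le)
    finally have "(\<Sum>k=1..n. b k)\<^sup>2 \<le> 2 * C\<^sup>2 + 2 * (r / 4 * real n)" by simp
    then have "(1 / real n) * (\<Sum>k=1..n. b k)\<^sup>2 \<le> (1 / real n) * (2 * C\<^sup>2 + 2 * (r / 4 * real n))"
      by (intro mult_left_mono) auto
    also have "\<dots> = (2 * C\<^sup>2) * (1 / real n) + r / 2"
      using n by (simp add: field_simps)
    also have "\<dots> < r" using N[of n] n by (auto simp: abs_less_iff)
    finally show ?thesis by simp
  qed
  then show "\<exists>no. \<forall>n\<ge>no. norm ((1 / real n) * (\<Sum>k=1..n. b k)\<^sup>2 - 0) < r" by blast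
qed

lemma average_tendsto_0:
  fixes f :: "nat \<Rightarrow> real"
  assumes f: "f \<longlonglongrightarrow> 0" and nn: "\<And>k. 0 \<le> f k"
  shows "(\<lambda>n. (1 / real n) * (\<Sum>k=1..n. f k)) \<longlonglongrightarrow> 0"
proof (rule LIMSEQ_I)
  fix r :: real assume r: "0 < r"
  then obtain K where K: "\<forall>k\<ge>K. norm (f k - 0) < r / 2"
    using LIMSEQ_D[OF f, of "r / 2"] by auto
  define C where "C = (\<Sum>k<K. f k)"
  have "(\<lambda>n. C * (1 / real n)) \<longlonglongrightarrow> C * 0"
    by (intro tendsto_mult tendsto_const lim_1_over_n)
  from LIMSEQ_D[OF this, of "r / 2"] r obtain N where
    N: "\<And>n. n \<ge> N \<Longrightarrow> \<bar>C * (1 / real n)\<bar> < r / 2" by auto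
  have "norm ((1 / real n) * (\<Sum>k=1..n. f k) - 0) < r" if n: "n \<ge> max N 1" for n
  proof -
    have "(\<Sum>k=1..n. f k) \<le> (\<Sum>k\<in>{..<K} \<union> {k\<in>{1..n}. K \<le> k}. f k)"
      by (intro sum_mono2) (auto simp: nn)
    also have "\<dots> = C + (\<Sum>k\<in>{k\<in>{1..n}. K \<le> k}. f k)"
      unfolding C_def by (intro sum.union_disjoint) auto
    also have "(\<Sum>k\<in>{k\<in>{1..n}. K \<le> k}. f k) \<le> (\<Sum>k\<in>{k\<in>{1..n}. K \<le> k}. r / 2)"
      using K by (intro sum_mono) (force simp: abs_less_iff)
    also have "\<dots> \<le> (\<Sum>k=1..n. r / 2)"
      using r by (intro sum_mono2) auto
    also have "\<dots> = real n * (r / 2)" by simp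
    finally have "(1 / real n) * (\<Sum>k=1..n. f k) \<le> (1 / real n) * (C + real n * (r / 2))"
      by (intro mult_left_mono) auto
    also have "\<dots> = C * (1 / real n) + r / 2" using n by (simp add: field_simps)
    also have "\<dots> < r" using N[of n] n by (simp only: abs_less_iff) linarith
    finally show ?thesis by (simp add: sum_nonneg nn)
  qed
  then show "\<exists>no. \<forall>n\<ge>no. norm ((1 / real n) * (\<Sum>k=1..n. f k) - 0) < r" by blast
qed

lemma SUP_ereal_tendsto_0_imp:
  assumes "(\<lambda>N::nat. SUP n\<in>{N..}. ereal (c N n)) \<longlonglongrightarrow> 0" and e: "0 < e"
  shows "\<exists>N0. \<forall>N\<ge>N0. \<forall>n\<ge>N. c N n < e"
proof -
  have "eventually (\<lambda>N. (SUP n\<in>{N..}. ereal (c N n)) < ereal e) sequentially"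
    using e by (intro order_tendstoD(2)[OF assms(1)]) simp
  then obtain N0 where N0: "\<And>N. N \<ge> N0 \<Longrightarrow> (SUP n\<in>{N..}. ereal (c N n)) < ereal e"
    unfolding eventually_sequentially by blast
  have "c N n < e" if "N \<ge> N0" "n \<ge> N" for N n
  proof -
    have "ereal (c N n) \<le> (SUP n\<in>{N..}. ereal (c N n))"
      using that(2) by (intro SUP_upper) simp
    also have "\<dots> < ereal e" using that(1) by (rule N0)
    finally show ?thesis by simp
  qed
  then show ?thesis by blast
qed

lemma SUP_ereal_tendsto_0:
  assumes "\<And>e. 0 < e \<Longrightarrow> \<exists>N0. \<forall>N\<ge>N0. \<forall>n\<ge>N. \<bar>c N n\<bar> \<le> e"
  shows "(\<lambda>N::nat. SUP n\<in>{N..}. ereal (c N n)) \<longlonglongrightarrow> 0"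
proof (rule order_tendstoI)
  fix a :: ereal assume "a < 0"
  then obtain b where b: "a < ereal b" "ereal b < 0" using ereal_dense2 by blast
  then obtain N0 where N0: "\<And>N n. N \<ge> N0 \<Longrightarrow> n \<ge> N \<Longrightarrow> \<bar>c N n\<bar> \<le> - b"
    using assms[of "- b"] by auto
  show "eventually (\<lambda>N. a < (SUP n\<in>{N..}. ereal (c N n))) sequentially"
  proof (rule eventually_sequentiallyI[of N0])
    fix N assume "N0 \<le> N"
    \<comment> \<open>for the lower bound the single index \<open>n = N\<close> suffices\<close>
    then have "b \<le> c N N" using N0[of N N] by simp
    then have "a < ereal (c N N)" using b(1) by (metis ereal_less_eq(3) order_less_le_trans)
    also have "\<dots> \<le> (SUP n\<in>{N..}. ereal (c N n))" by (intro SUP_upper) simp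
    finally show "a < (SUP n\<in>{N..}. ereal (c N n))" .
  qed
next
  fix a :: ereal assume "0 < a"
  then obtain b where b: "0 < ereal b" "ereal b < a" using ereal_dense2 by blast
  then obtain N0 where N0: "\<And>N n. N \<ge> N0 \<Longrightarrow> n \<ge> N \<Longrightarrow> \<bar>c N n\<bar> \<le> b"
    using assms[of b] by auto
  show "eventually (\<lambda>N. (SUP n\<in>{N..}. ereal (c N n)) < a) sequentially"
  proof (rule eventually_sequentiallyI[of N0])
    fix N assume "N0 \<le> N"
    then have "(SUP n\<in>{N..}. ereal (c N n)) \<le> ereal b"
      using N0[of N] by (intro SUP_least) (force simp: abs_le_iff)
    then show "(SUP n\<in>{N..}. ereal (c N n)) < a" using b(2) by (rule order_le_less_trans)
  qed
qed

section \<open>Conditional expectations as orthogonal projections\<close>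

context prob_space
begin

lemma subalgebra_sigma_finite: "subalgebra M F \<Longrightarrow> sigma_finite_subalgebra M F"
  by (intro finite_measure_subalgebra_is_sigma_finite finite_measure_subalgebra.intro
      finite_measure_subalgebra_axioms.intro finite_measure_axioms)

text \<open>
  Jensen's inequality for the square.
\<close>

lemma square_integrable_cond_exp [simp]:
  assumes F: "subalgebra M F" and f: "square_integrable M f"
  shows "square_integrable M (real_cond_exp M F f)"
proof -
  interpret sigma_finite_subalgebra M F using F by (rule subalgebra_sigma_finite)
  have "integrable M (\<lambda>\<omega>. (real_cond_exp M F f \<omega>)\<^sup>2)"
  proof (rule integrable_convex_cond_exp[where q = "\<lambda>x. x\<^sup>2" and I = UNIV])
    show "integrable M f" using f by (rule square_integrable_integrable)
    show "integrable M (\<lambda>\<omega>. (f \<omega>)\<^sup>2)" using f by (simp add: square_integrable_def)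
  qed (simp_all add: convex_power2)
  then show ?thesis by (simp add: square_integrable_def)
qed

lemma l2inner_cond_exp:
  assumes F: "subalgebra M F" and "square_integrable M f" "square_integrable M g"
    and "g \<in> borel_measurable F"
  shows "l2inner M (real_cond_exp M F f) g = l2inner M f g"
proof -
  interpret sigma_finite_subalgebra M F using F by (rule subalgebra_sigma_finite)
  show ?thesis
    using real_cond_exp_intg(2)[of g f] square_integrable_mult_integrable[OF assms(3,2)] assms
    by (simp add: l2inner_def mult.commute square_integrable_measurable)
qed

lemma l2inner_cond_exp_both:
  assumes "subalgebra M F" "square_integrable M f" "square_integrable M g"
  shows "l2inner M (real_cond_exp M F f) (real_cond_exp M F g) = l2inner M f (real_cond_exp M F g)"
  using assms by (intro l2inner_cond_exp) auto

text \<open>Pythagoras for a pair of nested projections, the larger of which may be the identity.\<close>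

lemma l2norm_cond_exp_residual:
  assumes F: "subalgebra M F" and f: "square_integrable M f"
  shows "(l2norm M (\<lambda>\<omega>. f \<omega> - real_cond_exp M F f \<omega>))\<^sup>2
    = (l2norm M f)\<^sup>2 - (l2norm M (real_cond_exp M F f))\<^sup>2"
  using l2norm_power2_diff[OF f square_integrable_cond_exp[OF F f]]
    l2inner_cond_exp_both[OF F f f]
  by (simp add: l2norm_power2)

lemma l2norm_cond_exp_increment:
  assumes G: "subalgebra M G" and FG: "subalgebra G F" and f: "square_integrable M f"
  shows "(l2norm M (\<lambda>\<omega>. real_cond_exp M G f \<omega> - real_cond_exp M F f \<omega>))\<^sup>2
    = (l2norm M (real_cond_exp M G f))\<^sup>2 - (l2norm M (real_cond_exp M F f))\<^sup>2"
proof -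
  have F: "subalgebra M F" using G FG by (auto simp: subalgebra_def)
  have "l2inner M (real_cond_exp M G f) (real_cond_exp M F f) = l2inner M f (real_cond_exp M F f)"
    using G F f by (intro l2inner_cond_exp) (auto intro: measurable_from_subalg[OF FG])
  then show ?thesis
    using l2norm_power2_diff[OF square_integrable_cond_exp[OF G f] square_integrable_cond_exp[OF F f]]
      l2inner_cond_exp_both[OF F f f]
    by (simp add: l2norm_power2)
qed

lemma l2norm_cond_exp_mono:
  assumes G: "subalgebra M G" and FG: "subalgebra G F" and f: "square_integrable M f"
  shows "l2norm M (real_cond_exp M F f) \<le> l2norm M (real_cond_exp M G f)"
proof (rule power2_le_imp_le)
  have "0 \<le> (l2norm M (\<lambda>\<omega>. real_cond_exp M G f \<omega> - real_cond_exp M F f \<omega>))\<^sup>2"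
    by (rule zero_le_power2)
  then show "(l2norm M (real_cond_exp M F f))\<^sup>2 \<le> (l2norm M (real_cond_exp M G f))\<^sup>2"
    unfolding l2norm_cond_exp_increment[OF assms] by linarith
qed (rule l2norm_nonneg)

lemma l2norm_cond_exp_le:
  assumes F: "subalgebra M F" and f: "square_integrable M f"
  shows "l2norm M (real_cond_exp M F f) \<le> l2norm M f"
proof (rule power2_le_imp_le)
  have "0 \<le> (l2norm M (\<lambda>\<omega>. f \<omega> - real_cond_exp M F f \<omega>))\<^sup>2"
    by (rule zero_le_power2)
  then show "(l2norm M (real_cond_exp M F f))\<^sup>2 \<le> (l2norm M f)\<^sup>2"
    unfolding l2norm_cond_exp_residual[OF assms] by linarith
qed (rule l2norm_nonneg)

end

section \<open>The Koopman operator and the past filtration\<close>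

locale filtered_dynamics = prob_space M for M :: "'a measure" +
  fixes T :: "'a \<Rightarrow> 'a" and F0 :: "'a measure"
  assumes T: "bimeasurable_preserving M T"
    and F0: "subalgebra M F0"
    and F0_increasing: "sets F0 \<subseteq> sets (filt M T F0 1)"
begin

lemma T_bij: "bij_betw T (space M) (space M)"
  and T_measurable [measurable]: "T \<in> measurable M M"
  and T_distr: "distr M M T = M"
  using T by (auto simp: bimeasurable_preserving_def)

lemma T_space: "\<omega> \<in> space M \<Longrightarrow> T \<omega> \<in> space M"
  using measurable_space[OF T_measurable] .

lemma funpow_measurable [measurable]: "T ^^ k \<in> measurable M M"
proof (induction k)
  case (Suc k)
  then show ?case unfolding funpow.simps by (rule measurable_comp[OF _ T_measurable])
qed (simp add: id_def)

lemma funpow_space: "\<omega> \<in> space M \<Longrightarrow> (T ^^ k) \<omega> \<in> space M"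
  using measurable_space[OF funpow_measurable] .

lemma funpow_bij: "bij_betw (T ^^ k) (space M) (space M)"
  using T_bij by (rule bij_betw_funpow)

lemma funpow_distr: "distr M M (T ^^ k) = M"
proof (induction k)
  case 0
  then show ?case using distr_id[of M] by (simp add: id_def)
next
  case (Suc k)
  have "distr M M (T \<circ> T ^^ k) = distr (distr M M (T ^^ k)) M T"
    by (rule distr_distr[symmetric]) auto
  then show ?case unfolding funpow.simps(2) Suc T_distr .
qed

lemma integral_funpow:
  fixes f :: "'a \<Rightarrow> real"
  assumes "f \<in> borel_measurable M"
  shows "(\<integral>\<omega>. f ((T ^^ k) \<omega>) \<partial>M) = (\<integral>\<omega>. f \<omega> \<partial>M)"
  using integral_distr[OF funpow_measurable[of k] assms] by (simp add: funpow_distr)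

lemma integrable_funpow:
  fixes f :: "'a \<Rightarrow> real"
  assumes "integrable M f"
  shows "integrable M (\<lambda>\<omega>. f ((T ^^ k) \<omega>))"
  using integrable_distr[OF funpow_measurable[of k], of f] assms by (simp add: funpow_distr)

lemma AE_funpow:
  assumes "AE \<omega> in M. Q \<omega>"
  shows "AE \<omega> in M. Q ((T ^^ k) \<omega>)"
  using AE_distrD[of "T ^^ k" M M Q] assms unfolding funpow_distr by simp

lemma square_integrable_funpow:
  assumes "square_integrable M f"
  shows "square_integrable M (\<lambda>\<omega>. f ((T ^^ k) \<omega>))"
  using assms integrable_funpow[of "\<lambda>\<omega>. (f \<omega>)\<^sup>2" k]
  by (auto simp: square_integrable_def)

lemma l2norm_funpow:
  assumes "square_integrable M f"
  shows "l2norm M (\<lambda>\<omega>. f ((T ^^ k) \<omega>)) = l2norm M f"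
  using assms integral_funpow[of "\<lambda>\<omega>. (f \<omega>)\<^sup>2" k]
  by (auto simp: l2norm_def square_integrable_def)

lemma square_integrable_T:
  "square_integrable M f \<Longrightarrow> square_integrable M (\<lambda>\<omega>. f (T \<omega>))"
  using square_integrable_funpow[of f 1] by simp

lemma l2norm_T:
  "square_integrable M f \<Longrightarrow> l2norm M (\<lambda>\<omega>. f (T \<omega>)) = l2norm M f"
  using l2norm_funpow[of f 1] by simp

text \<open>
  Only the projections onto \<open>\<F>\<^sub>0\<close> and its past occur in the argument, so the filtration is indexed
  backwards by the natural numbers: \<open>past n\<close> is \<open>\<F>\<^sub>-\<^sub>n\<close> and decreases in \<open>n\<close>.
\<close>

definition past :: "nat \<Rightarrow> 'a measure" where
  "past n = filt M T F0 (- int n)"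

abbreviation E :: "nat \<Rightarrow> ('a \<Rightarrow> real) \<Rightarrow> 'a \<Rightarrow> real" where
  "E n \<equiv> real_cond_exp M (past n)"

lemma space_past [simp]: "space (past n) = space M"
  by (simp add: past_def filt_def)

text \<open>
  Describing \<open>\<F>\<^sub>-\<^sub>n\<close> through preimages under \<open>T\<^sup>n\<close> removes the inverse map from all later arguments.
\<close>

lemma sets_past:
  "A \<in> sets (past n) \<longleftrightarrow> A \<subseteq> space M \<and> (T ^^ n) -` A \<inter> space M \<in> sets F0"
proof -
  define V where "V = inv_into (space M) T"
  have V: "bij_betw (V ^^ n) (space M) (space M)"
    unfolding V_def by (intro bij_betw_funpow bij_betw_inv_into T_bij)
  have Vn: "(V ^^ n) ((T ^^ n) \<omega>) = \<omega>" if "\<omega> \<in> space M" for \<omega>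
  proof (induction n)
    case (Suc n)
    have "(V ^^ Suc n) ((T ^^ Suc n) \<omega>) = (V ^^ n) (V (T ((T ^^ n) \<omega>)))"
      by (simp add: funpow_swap1)
    also have "V (T ((T ^^ n) \<omega>)) = (T ^^ n) \<omega>"
      unfolding V_def using T_bij funpow_space[OF that]
      by (intro inv_into_f_f) (auto simp: bij_betw_def)
    finally show ?case using Suc by simp
  qed simp
  have Tn: "(T ^^ n) ((V ^^ n) \<omega>) = \<omega>" if \<omega>: "\<omega> \<in> space M" for \<omega>
  proof -
    obtain \<eta> where "\<eta> \<in> space M" "\<omega> = (T ^^ n) \<eta>"
      using \<omega> funpow_bij[of n] by (auto simp: bij_betw_def)
    then show ?thesis using Vn by simp
  qed
  have spV: "(V ^^ n) \<omega> \<in> space M" if "\<omega> \<in> space M" for \<omega>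
    using V that by (auto simp: bij_betw_def)
  have "int_iter M T (- int n) = V ^^ n"
    by (cases "n = 0") (auto simp: int_iter_def V_def)
  then have *: "sets (past n) = {(V ^^ n) -` B \<inter> space M | B. B \<in> sets F0}"
    using spV F0 by (simp add: past_def filt_def sets_vimage_algebra2 subalgebra_def Pi_iff)
  show ?thesis
  proof
    assume "A \<in> sets (past n)"
    then obtain B where B: "B \<in> sets F0" "A = (V ^^ n) -` B \<inter> space M" using * by auto
    have "B \<subseteq> space M" using B(1) F0 sets.sets_into_space by (fastforce simp: subalgebra_def)
    then have "(T ^^ n) -` A \<inter> space M = B"
      using B(2) Vn funpow_space by auto
    then show "A \<subseteq> space M \<and> (T ^^ n) -` A \<inter> space M \<in> sets F0" using B by auto
  next
    assume A: "A \<subseteq> space M \<and> (T ^^ n) -` A \<inter> space M \<in> sets F0"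
    then have "A = (V ^^ n) -` ((T ^^ n) -` A \<inter> space M) \<inter> space M"
      using Tn spV by auto
    then show "A \<in> sets (past n)" using A * by blast
  qed
qed

lemma sets_past_0: "sets (past 0) = sets F0"
proof -
  have "A \<subseteq> space M" if "A \<in> sets F0" for A
    using sets.sets_into_space[OF that] F0 by (simp add: subalgebra_def)
  then show ?thesis by (auto simp: sets_past Int_absorb2)
qed

lemma E_0: "E 0 = real_cond_exp M F0"
proof -
  have "subalgebra M (past 0)" using F0 sets_past_0 by (simp add: subalgebra_def)
  moreover have "restr_to_subalg N (past 0) = restr_to_subalg N F0" for N
    by (simp add: restr_to_subalg_def sets_past_0)
  ultimately show ?thesis
    using F0 by (simp add: fun_eq_iff real_cond_exp_def nn_cond_exp_def)
qed

text \<open>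
  A set \<open>A\<close> of \<open>\<F>\<^sub>-\<^sub>n\<^sub>-\<^sub>1\<close> has \<open>T\<^sup>-\<^sup>1 (T\<^sup>-\<^sup>n A)\<close> in \<open>\<F>\<^sub>0 \<subseteq> T\<^sup>-\<^sup>1(\<F>\<^sub>0)\<close>; surjectivity of \<open>T\<close> cancels the outer preimage.
\<close>

lemma sets_past_Suc_subset: "sets (past (Suc n)) \<subseteq> sets (past n)"
proof
  fix A assume "A \<in> sets (past (Suc n))"
  then have A: "A \<subseteq> space M" "(T ^^ Suc n) -` A \<inter> space M \<in> sets F0"
    by (auto simp: sets_past simp del: funpow.simps)
  let ?C = "(T ^^ n) -` A \<inter> space M"
  have C: "T -` ?C \<inter> space M = (T ^^ Suc n) -` A \<inter> space M"
    using T_space by (auto simp: funpow_swap1)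
  have "sets (filt M T F0 1) = {T -` B \<inter> space M | B. B \<in> sets F0}"
    using T_space F0
    by (simp add: filt_def int_iter_def sets_vimage_algebra2 subalgebra_def Pi_iff)
  then obtain B where B: "B \<in> sets F0" "T -` ?C \<inter> space M = T -` B \<inter> space M"
    using A(2) F0_increasing C by auto
  have "B \<subseteq> space M" using B(1) F0 sets.sets_into_space by (fastforce simp: subalgebra_def)
  have surj: "T ` space M = space M" using T_bij by (simp add: bij_betw_def)
  have "X = T ` (T -` X \<inter> space M)" if "X \<subseteq> space M" for X
  proof
    show "X \<subseteq> T ` (T -` X \<inter> space M)"
    proof
      fix x assume x: "x \<in> X"
      then have "x \<in> T ` space M" using that surj by auto
      then show "x \<in> T ` (T -` X \<inter> space M)" using x by auto
    qed
  qed auto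
  from this[of ?C] this[of B] have "?C = B" using \<open>B \<subseteq> space M\<close> unfolding B(2) by blast
  then show "A \<in> sets (past n)" using A(1) B(1) by (simp add: sets_past)
qed

lemma sets_past_antimono: "m \<le> n \<Longrightarrow> sets (past n) \<subseteq> sets (past m)"
  using sets_past_Suc_subset by (rule lift_Suc_antimono_le[where f = "\<lambda>n. sets (past n)"])

lemma past_nested: "m \<le> n \<Longrightarrow> subalgebra (past m) (past n)"
  using sets_past_antimono by (simp add: subalgebra_def)

lemma past_subalgebra [simp]: "subalgebra M (past n)"
  using sets_past_antimono[of 0 n] F0 by (auto simp: subalgebra_def sets_past_0)

lemma sets_past_vimage:
  "B \<in> sets (past n) \<longleftrightarrow> (\<exists>A\<in>sets (past (Suc n)). B = T -` A \<inter> space M)"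
proof
  assume B: "B \<in> sets (past n)"
  then have Bs: "B \<subseteq> space M" using sets.sets_into_space by fastforce
  have inj: "T \<omega> \<in> T ` B \<longleftrightarrow> \<omega> \<in> B" if "\<omega> \<in> space M" for \<omega>
    using inj_on_image_mem_iff[of T "space M" \<omega> B] Bs that T_bij by (simp add: bij_betw_def)
  then have eq: "B = T -` (T ` B) \<inter> space M"
    using Bs by blast
  have "T ` B \<subseteq> space M" using Bs T_space by auto
  moreover have "(T ^^ Suc n) -` (T ` B) \<inter> space M = (T ^^ n) -` B \<inter> space M"
  proof -
    have "(T ^^ Suc n) \<omega> \<in> T ` B \<longleftrightarrow> (T ^^ n) \<omega> \<in> B" if "\<omega> \<in> space M" for \<omega>
      using inj[OF funpow_space[OF that]] by simp
    then show ?thesis by blast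
  qed
  ultimately have "T ` B \<in> sets (past (Suc n))"
    using B by (simp add: sets_past del: funpow.simps)
  then show "\<exists>A\<in>sets (past (Suc n)). B = T -` A \<inter> space M" using eq by blast
next
  assume "\<exists>A\<in>sets (past (Suc n)). B = T -` A \<inter> space M"
  then obtain A where A: "A \<in> sets (past (Suc n))" "B = T -` A \<inter> space M" by blast
  have "(T ^^ n) -` B \<inter> space M = (T ^^ Suc n) -` A \<inter> space M"
    using A(2) funpow_space[of _ n] by auto
  then show "B \<in> sets (past n)"
    using A by (simp add: sets_past del: funpow.simps)
qed

lemma T_measurable_past: "T \<in> measurable (past n) (past (Suc n))"
proof (rule measurableI)
  fix A assume "A \<in> sets (past (Suc n))"
  then show "T -` A \<inter> space (past n) \<in> sets (past n)"
    unfolding space_past sets_past_vimage[of _ n] by blast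
qed (simp add: T_space)

text \<open>
  The intertwining relation \<open>\<E>(f \<circ> T | \<F>\<^sub>-\<^sub>n) = \<E>(f | \<F>\<^sub>-\<^sub>n\<^sub>-\<^sub>1) \<circ> T\<close>: the sets of
  \<open>\<F>\<^sub>-\<^sub>n\<close> are exactly the preimages under \<open>T\<close> of those of \<open>\<F>\<^sub>-\<^sub>n\<^sub>-\<^sub>1\<close>, and \<open>T\<close> preserves integrals.
\<close>

lemma cond_exp_T:
  assumes f: "square_integrable M f"
  shows "AE \<omega> in M. E n (\<lambda>\<omega>. f (T \<omega>)) \<omega> = E (Suc n) f (T \<omega>)"
proof -
  interpret S: sigma_finite_subalgebra M "past (Suc n)"
    by (rule subalgebra_sigma_finite) simp
  interpret N: sigma_finite_subalgebra M "past n"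
    by (rule subalgebra_sigma_finite) simp
  have int: "integrable M f" using f by (rule square_integrable_integrable)
  show ?thesis
  proof (rule N.real_cond_exp_charact)
    show "integrable M (\<lambda>\<omega>. f (T \<omega>))" "integrable M (\<lambda>\<omega>. E (Suc n) f (T \<omega>))"
      by (rule square_integrable_integrable square_integrable_T square_integrable_cond_exp
          past_subalgebra f)+
    show "(\<lambda>\<omega>. E (Suc n) f (T \<omega>)) \<in> borel_measurable (past n)"
      by (rule measurable_compose[OF T_measurable_past borel_measurable_cond_exp])
    fix B assume "B \<in> sets (past n)"
    then obtain A where A: "A \<in> sets (past (Suc n))" "B = T -` A \<inter> space M"
      using sets_past_vimage[THEN iffD1, of B n] by blast
    have AM [measurable]: "A \<in> sets M" using A(1) past_subalgebra[of "Suc n"] unfolding subalgebra_def by blast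
    have transfer: "(\<integral>\<omega>\<in>B. g (T \<omega>) \<partial>M) = (\<integral>\<omega>\<in>A. g \<omega> \<partial>M)"
      if [measurable]: "g \<in> borel_measurable M" for g :: "'a \<Rightarrow> real"
    proof -
      have "(\<integral>\<omega>\<in>B. g (T \<omega>) \<partial>M) = (\<integral>\<omega>. indicator A (T \<omega>) *\<^sub>R g (T \<omega>) \<partial>M)"
        unfolding set_lebesgue_integral_def A(2)
        by (intro Bochner_Integration.integral_cong) (simp_all add: indicator_def)
      also have "\<dots> = (\<integral>\<omega>\<in>A. g \<omega> \<partial>M)"
        unfolding set_lebesgue_integral_def
        using integral_funpow[of "\<lambda>\<omega>. indicator A \<omega> *\<^sub>R g \<omega>" 1] that by simp
      finally show ?thesis .
    qed
    show "(\<integral>\<omega>\<in>B. f (T \<omega>) \<partial>M) = (\<integral>\<omega>\<in>B. E (Suc n) f (T \<omega>) \<partial>M)"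
      unfolding transfer[OF borel_measurable_cond_exp2]
        transfer[OF square_integrable_measurable[OF f]]
      by (rule S.real_cond_exp_intA[OF int A(1)])
  qed
qed

lemma cond_exp_cong:
  assumes "AE \<omega> in M. f \<omega> = g \<omega>" "square_integrable M f" "square_integrable M g"
  shows "AE \<omega> in M. E n f \<omega> = E n g \<omega>"
proof -
  interpret sigma_finite_subalgebra M "past n" by (rule subalgebra_sigma_finite) simp
  show ?thesis using assms by (intro real_cond_exp_cong) (auto dest: square_integrable_measurable)
qed

lemma cond_exp_diff:
  assumes "square_integrable M f" "square_integrable M g"
  shows "AE \<omega> in M. E n (\<lambda>\<omega>. f \<omega> - g \<omega>) \<omega> = E n f \<omega> - E n g \<omega>"
proof -
  interpret sigma_finite_subalgebra M "past n" by (rule subalgebra_sigma_finite) simp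
  show ?thesis using assms by (intro real_cond_exp_diff) (auto intro: square_integrable_integrable)
qed

lemma cond_exp_add:
  assumes "square_integrable M f" "square_integrable M g"
  shows "AE \<omega> in M. E n (\<lambda>\<omega>. f \<omega> + g \<omega>) \<omega> = E n f \<omega> + E n g \<omega>"
proof -
  interpret sigma_finite_subalgebra M "past n" by (rule subalgebra_sigma_finite) simp
  show ?thesis using assms by (intro real_cond_exp_add) (auto intro: square_integrable_integrable)
qed

lemma cond_exp_sum:
  assumes "\<And>k. square_integrable M (f k)"
  shows "AE \<omega> in M. E n (\<lambda>\<omega>. \<Sum>k\<in>I. f k \<omega>) \<omega> = (\<Sum>k\<in>I. E n (f k) \<omega>)"
proof -
  interpret sigma_finite_subalgebra M "past n" by (rule subalgebra_sigma_finite) simp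
  show ?thesis using assms by (intro real_cond_exp_sum) (auto intro: square_integrable_integrable)
qed

lemma cond_exp_past_measurable:
  assumes "square_integrable M f" "f \<in> borel_measurable (past m)" "n \<le> m"
  shows "AE \<omega> in M. E n f \<omega> = f \<omega>"
proof -
  interpret sigma_finite_subalgebra M "past n" by (rule subalgebra_sigma_finite) simp
  show ?thesis using assms past_nested[OF assms(3)]
    by (intro real_cond_exp_F_meas)
      (auto intro: square_integrable_integrable measurable_from_subalg)
qed

lemma cond_exp_tower:
  assumes "square_integrable M f" "m \<le> n"
  shows "AE \<omega> in M. E n (E m f) \<omega> = E n f \<omega>"
proof -
  interpret sigma_finite_subalgebra M "past n" by (rule subalgebra_sigma_finite) simp
  show ?thesis using assms past_nested
    by (intro real_cond_exp_nested_subalg) (auto intro: square_integrable_integrable)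
qed

lemma cond_exp_funpow:
  assumes f: "square_integrable M f"
  shows "AE \<omega> in M. E n (\<lambda>\<omega>. f ((T ^^ k) \<omega>)) \<omega> = E (n + k) f ((T ^^ k) \<omega>)"
proof (induction k arbitrary: n)
  case (Suc k)
  have "AE \<omega> in M. E n (\<lambda>\<omega>. f ((T ^^ k) (T \<omega>))) \<omega> = E (Suc n) (\<lambda>\<omega>. f ((T ^^ k) \<omega>)) (T \<omega>)"
    using f by (intro cond_exp_T square_integrable_funpow)
  moreover have "AE \<omega> in M. E (Suc n) (\<lambda>\<omega>. f ((T ^^ k) \<omega>)) (T \<omega>)
      = E (Suc n + k) f ((T ^^ k) (T \<omega>))"
    using AE_funpow[OF Suc[of "Suc n"], of 1] by simp
  ultimately show ?case by eventually_elim (simp add: funpow_swap1)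
qed simp

section \<open>The martingale decomposition of partial sums\<close>

definition birkhoff_sum :: "nat \<Rightarrow> ('a \<Rightarrow> real) \<Rightarrow> 'a \<Rightarrow> real" where
  "birkhoff_sum n f \<omega> = (\<Sum>k<n. f ((T ^^ k) \<omega>))"

definition innovation :: "('a \<Rightarrow> real) \<Rightarrow> 'a \<Rightarrow> real" where
  "innovation f \<omega> = E 0 f \<omega> - E 1 f \<omega>"

lemma square_integrable_E [simp]:
  "square_integrable M f \<Longrightarrow> square_integrable M (E n f)"
  by simp

lemma square_integrable_birkhoff_sum [simp]:
  "square_integrable M f \<Longrightarrow> square_integrable M (birkhoff_sum n f)"
  unfolding birkhoff_sum_def[abs_def]
  by (intro square_integrable_sum square_integrable_funpow)

lemma square_integrable_innovation [simp]:
  "square_integrable M f \<Longrightarrow> square_integrable M (innovation f)"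
  unfolding innovation_def[abs_def] by (intro square_integrable_diff square_integrable_E)

lemma birkhoff_sum_Suc: "birkhoff_sum (Suc n) f \<omega> = f \<omega> + birkhoff_sum n f (T \<omega>)"
  unfolding birkhoff_sum_def by (subst sum.lessThan_Suc_shift) (simp add: funpow_swap1)

lemma birkhoff_sum_T: "birkhoff_sum n f (T \<omega>) = (\<Sum>k=1..n. f ((T ^^ k) \<omega>))"
proof -
  have "(\<Sum>k=1..n. f ((T ^^ k) \<omega>)) = (\<Sum>k<n. f ((T ^^ Suc k) \<omega>))"
    by (rule sum.reindex_bij_witness[of _ Suc "\<lambda>k. k - 1"]) auto
  then show ?thesis by (simp add: birkhoff_sum_def funpow_swap1)
qed

lemma birkhoff_sum_diff:
  "birkhoff_sum n (\<lambda>\<omega>. f \<omega> - g \<omega>) \<omega> = birkhoff_sum n f \<omega> - birkhoff_sum n g \<omega>"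
  by (simp add: birkhoff_sum_def sum_subtractf)

lemma l2norm_power2_innovation:
  assumes "square_integrable M f"
  shows "(l2norm M (innovation f))\<^sup>2 = (l2norm M (E 0 f))\<^sup>2 - (l2norm M (E 1 f))\<^sup>2"
  unfolding innovation_def[abs_def]
  using assms past_nested[of 0 1] by (intro l2norm_cond_exp_increment) auto

lemma l2norm_E_T:
  assumes "square_integrable M f"
  shows "l2norm M (E n (\<lambda>\<omega>. f (T \<omega>))) = l2norm M (E (Suc n) f)"
proof -
  have "l2norm M (E n (\<lambda>\<omega>. f (T \<omega>))) = l2norm M (\<lambda>\<omega>. E (Suc n) f (T \<omega>))"
    using assms by (intro l2norm_cong_AE cond_exp_T square_integrable_E square_integrable_T)
  then show ?thesis using l2norm_T[OF square_integrable_E[OF assms]] by simp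
qed

lemma l2norm_E_funpow:
  assumes "square_integrable M f"
  shows "l2norm M (E n (\<lambda>\<omega>. f ((T ^^ k) \<omega>))) = l2norm M (E (n + k) f)"
proof -
  have "l2norm M (E n (\<lambda>\<omega>. f ((T ^^ k) \<omega>))) = l2norm M (\<lambda>\<omega>. E (n + k) f ((T ^^ k) \<omega>))"
    using assms by (intro l2norm_cong_AE cond_exp_funpow square_integrable_E square_integrable_funpow)
  then show ?thesis using l2norm_funpow[OF square_integrable_E[OF assms]] by simp
qed

text \<open>
  Let \<open>B\<^sub>n = \<Sum>k<n. U\<^sup>k w\<close> and \<open>S\<^sub>n = U B\<^sub>n\<close>, and consider the energy \<open>\<parallel>S\<^sub>n\<parallel>\<^sup>2 - \<parallel>E\<^sub>0 S\<^sub>n\<parallel>\<^sup>2\<close> of \<open>S\<^sub>n\<close> orthogonal to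
  \<open>\<F>\<^sub>0\<close>. Shifting by \<open>U\<close> turns it, for \<open>n + 1\<close>, into the energy of \<open>B\<^sub>n\<^sub>+\<^sub>1\<close> orthogonal to \<open>\<F>\<^sub>-\<^sub>1\<close>. This is
  the energy orthogonal to \<open>\<F>\<^sub>0\<close> plus \<open>\<parallel>P B\<^sub>n\<^sub>+\<^sub>1\<parallel>\<^sup>2\<close>; and since \<open>B\<^sub>n\<^sub>+\<^sub>1 = w + S\<^sub>n\<close> with \<open>w\<close> measurable
  with respect to \<open>\<F>\<^sub>0\<close>, the energy orthogonal to \<open>\<F>\<^sub>0\<close> is that of \<open>S\<^sub>n\<close>.
\<close>

lemma martingale_decomposition:
  assumes w: "square_integrable M w" "w \<in> borel_measurable (past 0)"
  shows "(l2norm M (\<lambda>\<omega>. birkhoff_sum n w (T \<omega>)))\<^sup>2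
    = (l2norm M (E 0 (\<lambda>\<omega>. birkhoff_sum n w (T \<omega>))))\<^sup>2
      + (\<Sum>j=1..n. (l2norm M (innovation (birkhoff_sum j w)))\<^sup>2)"
proof (induction n)
  case 0
  have "l2norm M (E 0 (\<lambda>\<omega>. 0)) \<le> l2norm M (\<lambda>\<omega>. 0)"
    by (rule l2norm_cond_exp_le) simp_all
  then have "l2norm M (E 0 (\<lambda>\<omega>. 0)) = 0"
    using l2norm_nonneg[of M "E 0 (\<lambda>\<omega>. 0)"] by simp
  then show ?case by (simp add: birkhoff_sum_def)
next
  case (Suc n)
  define B where "B = birkhoff_sum (Suc n) w"
  define S where "S \<omega> = birkhoff_sum n w (T \<omega>)" for \<omega>
  have B: "square_integrable M B" using w by (simp add: B_def)
  have S: "square_integrable M S"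
    unfolding S_def[abs_def] using w by (intro square_integrable_T) simp
  have BS: "B = (\<lambda>\<omega>. w \<omega> + S \<omega>)"
    by (simp add: fun_eq_iff B_def S_def birkhoff_sum_Suc)
  have "AE \<omega> in M. B \<omega> - E 0 B \<omega> = S \<omega> - E 0 S \<omega>"
    using cond_exp_add[OF w(1) S, of 0] cond_exp_past_measurable[OF w le_refl]
    unfolding BS by eventually_elim simp
  then have "l2norm M (\<lambda>\<omega>. B \<omega> - E 0 B \<omega>) = l2norm M (\<lambda>\<omega>. S \<omega> - E 0 S \<omega>)"
    using B S by (intro l2norm_cong_AE) simp_all
  then have residual: "(l2norm M B)\<^sup>2 - (l2norm M (E 0 B))\<^sup>2 = (l2norm M S)\<^sup>2 - (l2norm M (E 0 S))\<^sup>2"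
    using l2norm_cond_exp_residual[OF past_subalgebra B] l2norm_cond_exp_residual[OF past_subalgebra S]
    by metis
  have "(l2norm M (\<lambda>\<omega>. B (T \<omega>)))\<^sup>2 - (l2norm M (E 0 (\<lambda>\<omega>. B (T \<omega>))))\<^sup>2
      = (l2norm M B)\<^sup>2 - (l2norm M (E 1 B))\<^sup>2"
    using l2norm_T[OF B] l2norm_E_T[OF B, of 0] by simp
  also have "\<dots> = (l2norm M S)\<^sup>2 - (l2norm M (E 0 S))\<^sup>2 + (l2norm M (innovation B))\<^sup>2"
    using residual l2norm_power2_innovation[OF B] by simp
  finally show ?case
    using Suc.IH unfolding B_def S_def[abs_def] by simp
qed

lemma innovation_funpow:
  assumes "square_integrable M f"
  shows "AE \<omega> in M. innovation (\<lambda>\<omega>. f ((T ^^ k) \<omega>)) \<omega>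
    = E k f ((T ^^ k) \<omega>) - E (Suc k) f ((T ^^ k) \<omega>)"
  using cond_exp_funpow[OF assms, of 0 k] cond_exp_funpow[OF assms, of 1 k]
  by eventually_elim (simp add: innovation_def)

lemma l2norm_power2_innovation_funpow:
  assumes "square_integrable M f"
  shows "(l2norm M (innovation (\<lambda>\<omega>. f ((T ^^ k) \<omega>))))\<^sup>2
    = (l2norm M (E k f))\<^sup>2 - (l2norm M (E (Suc k) f))\<^sup>2"
  using l2norm_power2_innovation[OF square_integrable_funpow[OF assms]]
    l2norm_E_funpow[OF assms, of 0] l2norm_E_funpow[OF assms, of 1]
  by simp

lemma innovation_funpow_cong:
  assumes f: "square_integrable M f" and g: "square_integrable M g"
    and "AE \<omega> in M. E k f \<omega> = E k g \<omega>" "AE \<omega> in M. E (Suc k) f \<omega> = E (Suc k) g \<omega>"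
  shows "AE \<omega> in M. innovation (\<lambda>\<omega>. f ((T ^^ k) \<omega>)) \<omega> = innovation (\<lambda>\<omega>. g ((T ^^ k) \<omega>)) \<omega>"
  using innovation_funpow[OF f, of k] innovation_funpow[OF g, of k]
    AE_funpow[OF assms(3), of k] AE_funpow[OF assms(4), of k]
  by eventually_elim simp

lemma innovation_funpow_eq_0:
  assumes f: "square_integrable M f"
    and "AE \<omega> in M. E k f \<omega> = E (Suc k) f \<omega>"
  shows "AE \<omega> in M. innovation (\<lambda>\<omega>. f ((T ^^ k) \<omega>)) \<omega> = 0"
  using innovation_funpow[OF f, of k] AE_funpow[OF assms(2), of k]
  by eventually_elim simp

lemma innovation_birkhoff_sum:
  assumes f: "square_integrable M f"
  shows "AE \<omega> in M. innovation (birkhoff_sum n f) \<omega>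
    = (\<Sum>k<n. innovation (\<lambda>\<omega>. f ((T ^^ k) \<omega>)) \<omega>)"
proof -
  note * = cond_exp_sum[of "\<lambda>k \<omega>. f ((T ^^ k) \<omega>)" _ "{..<n}", OF square_integrable_funpow[OF f]]
  show ?thesis
    using *[of 0] *[of 1] unfolding innovation_def[abs_def] birkhoff_sum_def[abs_def] sum_subtractf
    by eventually_elim simp
qed

lemma innovation_diff:
  assumes "square_integrable M f" "square_integrable M g"
  shows "AE \<omega> in M. innovation (\<lambda>\<omega>. f \<omega> - g \<omega>) \<omega> = innovation f \<omega> - innovation g \<omega>"
  using cond_exp_diff[OF assms, of 0] cond_exp_diff[OF assms, of 1]
  by eventually_elim (simp add: innovation_def)

lemma l2norm_E_birkhoff_sum_le:
  assumes w: "square_integrable M w"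
  shows "l2norm M (E 0 (\<lambda>\<omega>. birkhoff_sum n w (T \<omega>))) \<le> (\<Sum>k=1..n. l2norm M (E k w))"
proof -
  have sq: "square_integrable M (\<lambda>\<omega>. w ((T ^^ k) \<omega>))" for k
    by (rule square_integrable_funpow[OF w])
  have "l2norm M (E 0 (\<lambda>\<omega>. birkhoff_sum n w (T \<omega>)))
      = l2norm M (\<lambda>\<omega>. \<Sum>k=1..n. E 0 (\<lambda>\<omega>. w ((T ^^ k) \<omega>)) \<omega>)"
    unfolding birkhoff_sum_T using sq
    by (intro l2norm_cong_AE cond_exp_sum square_integrable_E square_integrable_sum)
  also have "\<dots> \<le> (\<Sum>k=1..n. l2norm M (E 0 (\<lambda>\<omega>. w ((T ^^ k) \<omega>))))"
    by (intro l2norm_sum_le square_integrable_E sq)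
  also have "\<dots> = (\<Sum>k=1..n. l2norm M (E k w))"
    using l2norm_E_funpow[OF w, of 0] by simp
  finally show ?thesis .
qed

lemma E_antimono:
  assumes "square_integrable M f" "m \<le> n"
  shows "l2norm M (E n f) \<le> l2norm M (E m f)"
  using assms past_nested by (intro l2norm_cond_exp_mono) auto

section \<open>Innovations under compensation and truncation\<close>

definition innovation_sum :: "('a \<Rightarrow> real) \<Rightarrow> nat \<Rightarrow> 'a \<Rightarrow> real" where
  "innovation_sum f n \<omega> = (\<Sum>k<n. innovation (\<lambda>\<omega>. f ((T ^^ k) \<omega>)) \<omega>)"

lemma square_integrable_innovation_sum [simp]:
  "square_integrable M f \<Longrightarrow> square_integrable M (innovation_sum f n)"
  unfolding innovation_sum_def[abs_def]
  by (intro square_integrable_sum square_integrable_innovation square_integrable_funpow)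

text \<open>
  Shifting by \<open>T\<close> shows \<open>\<parallel>E\<^sub>1 D\<parallel> = \<parallel>E\<^sub>0 (D \<circ> T)\<parallel> = 0\<close>, and the norms \<open>\<parallel>E\<^sub>k D\<parallel>\<close> decrease in \<open>k\<close>.
\<close>

lemma martingale_difference_E:
  assumes D: "square_integrable M D" and "AE \<omega> in M. E 0 (\<lambda>\<omega>. D (T \<omega>)) \<omega> = 0"
    and "1 \<le> k"
  shows "AE \<omega> in M. E k D \<omega> = 0"
proof -
  have "l2norm M (E 0 (\<lambda>\<omega>. D (T \<omega>))) = 0"
    using assms(2) D
    by (subst l2norm_eq_0_iff) (auto intro!: square_integrable_E square_integrable_T[OF D])
  then have "l2norm M (E 1 D) = 0" using l2norm_E_T[OF D, of 0] by simp
  then have "l2norm M (E k D) = 0"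
    using E_antimono[OF D assms(3)] l2norm_nonneg[of M "E k D"] by simp
  then show ?thesis using D by (subst (asm) l2norm_eq_0_iff) auto
qed

text \<open>
  Of the summands \<open>P (U\<^sup>k D)\<close> only \<open>k = 0\<close> survives, and \<open>P D = D\<close>.
\<close>

lemma innovation_birkhoff_sum_compensated:
  assumes x: "square_integrable M x" and D: "square_integrable M D" "D \<in> borel_measurable (past 0)"
    and md: "AE \<omega> in M. E 0 (\<lambda>\<omega>. D (T \<omega>)) \<omega> = 0"
    and j: "1 \<le> j"
  shows "AE \<omega> in M. innovation (birkhoff_sum j (\<lambda>\<omega>. x \<omega> - D \<omega>)) \<omega> = innovation_sum x j \<omega> - D \<omega>"
proof -
  have "AE \<omega> in M. innovation (\<lambda>\<omega>. D ((T ^^ Suc k) \<omega>)) \<omega> = 0" for k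
  proof (rule innovation_funpow_eq_0[OF D(1)])
    show "AE \<omega> in M. E (Suc k) D \<omega> = E (Suc (Suc k)) D \<omega>"
      using martingale_difference_E[OF D(1) md, of "Suc k"]
        martingale_difference_E[OF D(1) md, of "Suc (Suc k)"]
      by (auto elim: eventually_elim2)
  qed
  then have zero: "AE \<omega> in M. \<forall>k. innovation (\<lambda>\<omega>. D ((T ^^ Suc k) \<omega>)) \<omega> = 0"
    unfolding AE_all_countable by blast
  have first: "AE \<omega> in M. innovation D \<omega> = D \<omega>"
    using martingale_difference_E[OF D(1) md, of 1] cond_exp_past_measurable[OF D le_refl]
    by (auto simp: innovation_def elim: eventually_elim2)
  have "birkhoff_sum j (\<lambda>\<omega>. x \<omega> - D \<omega>) = (\<lambda>\<omega>. birkhoff_sum j x \<omega> - birkhoff_sum j D \<omega>)"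
    by (simp add: fun_eq_iff birkhoff_sum_diff)
  then have "AE \<omega> in M. innovation (birkhoff_sum j (\<lambda>\<omega>. x \<omega> - D \<omega>)) \<omega>
      = innovation (birkhoff_sum j x) \<omega> - innovation (birkhoff_sum j D) \<omega>"
    using x D(1) by (simp add: innovation_diff)
  then show ?thesis
    using innovation_birkhoff_sum[OF x, of j] innovation_birkhoff_sum[OF D(1), of j] zero first
  proof eventually_elim
    case (elim \<omega>)
    obtain i where i: "j = Suc i" using j by (cases j) auto
    have "(\<Sum>k<j. innovation (\<lambda>\<omega>. D ((T ^^ k) \<omega>)) \<omega>) = D \<omega>"
      unfolding i sum.lessThan_Suc_shift using elim(4,5) by simp
    then show ?case using elim(1-3) by (simp add: innovation_sum_def)
  qed
qed

text \<open>
  Up to the shift \<open>U\<^sup>k\<close>, the innovation of \<open>U\<^sup>k f\<close> is \<open>E\<^sub>k f - E\<^sub>k\<^sub>+\<^sub>1 f\<close>. For \<open>f = E\<^sub>N x\<close> it vanishes for \<open>k < N\<close>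
  and agrees with that of \<open>U\<^sup>k x\<close> for \<open>k \<ge> N\<close>.
\<close>

lemma innovation_birkhoff_sum_truncated:
  assumes x: "square_integrable M x"
  shows "AE \<omega> in M. innovation (birkhoff_sum j (E N x)) \<omega>
    = (if N \<le> j then innovation_sum x j \<omega> - innovation_sum x N \<omega> else 0)"
proof -
  have y: "square_integrable M (E N x)" using x by simp
  have low: "AE \<omega> in M. innovation (\<lambda>\<omega>. E N x ((T ^^ k) \<omega>)) \<omega> = 0" if "k < N" for k
  proof (rule innovation_funpow_eq_0[OF y])
    show "AE \<omega> in M. E k (E N x) \<omega> = E (Suc k) (E N x) \<omega>"
      using cond_exp_past_measurable[OF y borel_measurable_cond_exp, of k]
        cond_exp_past_measurable[OF y borel_measurable_cond_exp, of "Suc k"] that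
      by (auto elim: eventually_elim2)
  qed
  have high: "AE \<omega> in M. innovation (\<lambda>\<omega>. E N x ((T ^^ k) \<omega>)) \<omega>
      = innovation (\<lambda>\<omega>. x ((T ^^ k) \<omega>)) \<omega>" if "N \<le> k" for k
    using that x by (intro innovation_funpow_cong cond_exp_tower) simp_all
  have "AE \<omega> in M. \<forall>k. innovation (\<lambda>\<omega>. E N x ((T ^^ k) \<omega>)) \<omega>
      = (if N \<le> k then innovation (\<lambda>\<omega>. x ((T ^^ k) \<omega>)) \<omega> else 0)"
    unfolding AE_all_countable using low high by (metis (no_types, lifting) AE_cong linorder_not_le)
  then show ?thesis
    using innovation_birkhoff_sum[OF y, of j]
  proof eventually_elim
    case (elim \<omega>)
    let ?d = "\<lambda>k. innovation (\<lambda>\<omega>. x ((T ^^ k) \<omega>)) \<omega>"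
    have "innovation (birkhoff_sum j (E N x)) \<omega> = (\<Sum>k<j. if N \<le> k then ?d k else 0)"
      using elim by simp
    also have "\<dots> = (\<Sum>k\<in>{N..<j}. ?d k)"
      by (intro sum.mono_neutral_cong_right) auto
    also have "\<dots> = (if N \<le> j then (\<Sum>k<j. ?d k) - (\<Sum>k<N. ?d k) else 0)"
      using sum_diff_nat_ivl[of 0 N j ?d] by (simp add: lessThan_atLeast0)
    finally show ?case by (simp add: innovation_sum_def)
  qed
qed

lemma l2norm_E_truncated_le:
  assumes x: "square_integrable M x"
  shows "l2norm M (E k (E N x)) \<le> l2norm M (E k x)"
proof (cases "N \<le> k")
  case True
  then have "l2norm M (E k (E N x)) = l2norm M (E k x)"
    using x by (intro l2norm_cong_AE cond_exp_tower) simp_all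
  then show ?thesis by simp
next
  case False
  have "l2norm M (E k (E N x)) \<le> l2norm M (E N x)"
    using x by (intro l2norm_cond_exp_le) simp_all
  also have "\<dots> \<le> l2norm M (E k x)" using False x by (intro E_antimono) auto
  finally show ?thesis .
qed

section \<open>Slow oscillation\<close>

text \<open>
  Cauchy--Schwarz over at most \<open>m\<close> increments, whose squared norms \<open>\<parallel>E\<^sub>k x\<parallel>\<^sup>2 - \<parallel>E\<^sub>k\<^sub>+\<^sub>1 x\<parallel>\<^sup>2\<close> telescope.
\<close>

lemma innovation_sum_oscillation:
  assumes x: "square_integrable M x" and mj: "m \<le> j" "j \<le> 2 * m"
  shows "l2norm M (\<lambda>\<omega>. innovation_sum x j \<omega> - innovation_sum x m \<omega>)
    \<le> sqrt (real m * (l2norm M (E m x))\<^sup>2)"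
proof -
  let ?d = "\<lambda>k. l2norm M (innovation (\<lambda>\<omega>. x ((T ^^ k) \<omega>)))"
  let ?a = "\<lambda>k. (l2norm M (E k x))\<^sup>2"
  have "innovation_sum x j \<omega> - innovation_sum x m \<omega>
      = (\<Sum>k\<in>{m..<j}. innovation (\<lambda>\<omega>. x ((T ^^ k) \<omega>)) \<omega>)" for \<omega>
    using mj sum_diff_nat_ivl[of 0 m j "\<lambda>k. innovation (\<lambda>\<omega>. x ((T ^^ k) \<omega>)) \<omega>"]
    by (simp add: innovation_sum_def lessThan_atLeast0)
  then have "l2norm M (\<lambda>\<omega>. innovation_sum x j \<omega> - innovation_sum x m \<omega>) \<le> (\<Sum>k\<in>{m..<j}. ?d k)"
    using x l2norm_sum_le[of "{m..<j}" M "\<lambda>k. innovation (\<lambda>\<omega>. x ((T ^^ k) \<omega>))"]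
      square_integrable_innovation[OF square_integrable_funpow[OF x]] by simp
  also have "\<dots> \<le> sqrt (real m * ?a m)"
  proof (rule real_le_rsqrt)
    have "(\<Sum>k\<in>{m..<j}. ?d k)\<^sup>2 \<le> (\<Sum>k\<in>{m..<j}. (?d k)\<^sup>2) * real (card {m..<j})"
      by (rule sum_squared_le_sum_of_squares)
    also have "(\<Sum>k\<in>{m..<j}. (?d k)\<^sup>2) = ?a m - ?a j"
      using mj(1) sum_Suc_diff'[of m j "\<lambda>k. - ?a k"]
      by (simp add: l2norm_power2_innovation_funpow[OF x])
    also have "(?a m - ?a j) * real (card {m..<j}) \<le> ?a m * real m"
      using mj E_antimono[OF x mj(1)] by (intro mult_mono) auto
    finally show "(\<Sum>k\<in>{m..<j}. ?d k)\<^sup>2 \<le> real m * ?a m" by (simp add: mult.commute)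
  qed
  finally show ?thesis .
qed

end

locale summable_projections = filtered_dynamics +
  fixes x :: "'a \<Rightarrow> real"
  assumes x: "square_integrable M x" "x \<in> borel_measurable (past 0)"
    and summable_E: "summable (\<lambda>k. (l2norm M (E k x))\<^sup>2)"
begin

abbreviation projection_decay :: "nat \<Rightarrow> real" where
  "projection_decay m \<equiv> real m * (l2norm M (E m x))\<^sup>2"

lemma projection_decay_tendsto_0: "projection_decay \<longlonglongrightarrow> 0"
  using summable_E E_antimono[OF x(1)]
  by (intro summable_decseq_imp_mult_tendsto_0) (auto simp: decseq_def intro!: power_mono)

text \<open>
  The condition on \<open>w\<close> is satisfied both by \<open>x - D\<close>, as \<open>E\<^sub>k D = 0\<close> for \<open>k \<ge> 1\<close>, and by \<open>E\<^sub>N x\<close>; so the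
  \<open>\<F>\<^sub>0\<close>-measurable part of their partial sums has the same negligible bound.
\<close>

lemma conditional_part_le:
  assumes w: "square_integrable M w"
    and le: "\<And>k. 1 \<le> k \<Longrightarrow> l2norm M (E k w) \<le> l2norm M (E k x)"
  shows "(l2norm M (E 0 (\<lambda>\<omega>. birkhoff_sum n w (T \<omega>))))\<^sup>2 \<le> (\<Sum>k=1..n. l2norm M (E k x))\<^sup>2"
proof (rule power_mono)
  have "(\<Sum>k=1..n. l2norm M (E k w)) \<le> (\<Sum>k=1..n. l2norm M (E k x))"
    by (intro sum_mono le) auto
  then show "l2norm M (E 0 (\<lambda>\<omega>. birkhoff_sum n w (T \<omega>))) \<le> (\<Sum>k=1..n. l2norm M (E k x))"
    using l2norm_E_birkhoff_sum_le[OF w, of n] by simp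
qed simp

lemma conditional_part_tendsto_0:
  "(\<lambda>n. (1 / real n) * (\<Sum>k=1..n. l2norm M (E k x))\<^sup>2) \<longlonglongrightarrow> 0"
  using summable_E by (intro summable_power2_imp_average_tendsto_0) simp_all

section \<open>Martingale approximation and convergence of the series\<close>

text \<open>
  The martingale decomposition for \<open>w = x - D\<close>. The remainder \<open>r n\<close> is the squared norm of the part of the
  error that is measurable with respect to \<open>\<F>\<^sub>0\<close>; only its size matters.
\<close>

lemma approximation_error:
  assumes D: "square_integrable M D" "D \<in> borel_measurable (past 0)"
    and md: "AE \<omega> in M. E 0 (\<lambda>\<omega>. D (T \<omega>)) \<omega> = 0"
  obtains r where
    "\<And>n. (l2norm M (\<lambda>\<omega>. birkhoff_sum n x (T \<omega>) - (\<Sum>k=1..n. D ((T ^^ k) \<omega>))))\<^sup>2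
      = r n + (\<Sum>j=1..n. (l2norm M (\<lambda>\<omega>. innovation_sum x j \<omega> - D \<omega>))\<^sup>2)"
    "\<And>n. 0 \<le> r n" "\<And>n. r n \<le> (\<Sum>k=1..n. l2norm M (E k x))\<^sup>2"
proof
  let ?w = "\<lambda>\<omega>. x \<omega> - D \<omega>"
  let ?r = "\<lambda>n. (l2norm M (E 0 (\<lambda>\<omega>. birkhoff_sum n ?w (T \<omega>))))\<^sup>2"
  have w: "square_integrable M ?w" "?w \<in> borel_measurable (past 0)"
    using x D by simp_all
  fix n
  have "(l2norm M (innovation (birkhoff_sum j ?w)))\<^sup>2
      = (l2norm M (\<lambda>\<omega>. innovation_sum x j \<omega> - D \<omega>))\<^sup>2" if "1 \<le> j" for j
    using innovation_birkhoff_sum_compensated[OF x(1) D md that] x(1) D(1)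
    by (intro arg_cong[where f = "\<lambda>t. t\<^sup>2"] l2norm_cong_AE) simp_all
  then show "(l2norm M (\<lambda>\<omega>. birkhoff_sum n x (T \<omega>) - (\<Sum>k=1..n. D ((T ^^ k) \<omega>))))\<^sup>2
      = ?r n + (\<Sum>j=1..n. (l2norm M (\<lambda>\<omega>. innovation_sum x j \<omega> - D \<omega>))\<^sup>2)"
    using martingale_decomposition[OF w, of n]
    by (simp add: birkhoff_sum_diff birkhoff_sum_T[of n D])
  show "0 \<le> ?r n" by simp
  show "?r n \<le> (\<Sum>k=1..n. l2norm M (E k x))\<^sup>2"
  proof (rule conditional_part_le[OF w(1)])
    fix k :: nat assume k: "1 \<le> k"
    have "AE \<omega> in M. E k ?w \<omega> = E k x \<omega>"
      using cond_exp_diff[OF x(1) D(1), of k] martingale_difference_E[OF D(1) md k]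
      by eventually_elim simp
    then show "l2norm M (E k ?w) \<le> l2norm M (E k x)"
      using w x by (intro eq_refl l2norm_cong_AE) simp_all
  qed
qed

lemma approximation_iff_average:
  assumes D: "square_integrable M D" "D \<in> borel_measurable (past 0)"
    and md: "AE \<omega> in M. E 0 (\<lambda>\<omega>. D (T \<omega>)) \<omega> = 0"
  shows "(\<lambda>n. (1 / real n) *
      (l2norm M (\<lambda>\<omega>. birkhoff_sum n x (T \<omega>) - (\<Sum>k=1..n. D ((T ^^ k) \<omega>))))\<^sup>2) \<longlonglongrightarrow> 0
    \<longleftrightarrow> (\<lambda>n. (1 / real n) *
      (\<Sum>j=1..n. (l2norm M (\<lambda>\<omega>. innovation_sum x j \<omega> - D \<omega>))\<^sup>2)) \<longlonglongrightarrow> 0"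
    (is "?L \<longlonglongrightarrow> 0 \<longleftrightarrow> ?R \<longlonglongrightarrow> 0")
proof -
  obtain r where r: "\<And>n. (l2norm M (\<lambda>\<omega>. birkhoff_sum n x (T \<omega>) - (\<Sum>k=1..n. D ((T ^^ k) \<omega>))))\<^sup>2
      = r n + (\<Sum>j=1..n. (l2norm M (\<lambda>\<omega>. innovation_sum x j \<omega> - D \<omega>))\<^sup>2)"
    "\<And>n. 0 \<le> r n" "\<And>n. r n \<le> (\<Sum>k=1..n. l2norm M (E k x))\<^sup>2"
    using approximation_error[OF assms] by blast
  have r0: "(\<lambda>n. (1 / real n) * r n) \<longlonglongrightarrow> 0"
    by (intro tendsto_sandwich[OF _ _ tendsto_const conditional_part_tendsto_0]
        always_eventually allI mult_left_mono mult_nonneg_nonneg r(2,3)) simp_all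
  have eq: "?L n = (1 / real n) * r n + ?R n" for n
    unfolding r(1) by (simp add: distrib_left)
  show ?thesis
  proof
    assume "?L \<longlonglongrightarrow> 0"
    from tendsto_diff[OF this r0] show "?R \<longlonglongrightarrow> 0" unfolding eq by simp
  next
    assume "?R \<longlonglongrightarrow> 0"
    from tendsto_add[OF r0 this] show "?L \<longlonglongrightarrow> 0" unfolding eq by simp
  qed
qed

lemma innovation_sum_distance_le:
  assumes Z: "square_integrable M Z" and m: "0 < m"
  shows "(l2norm M (\<lambda>\<omega>. innovation_sum x m \<omega> - Z \<omega>))\<^sup>2
    \<le> 4 * ((1 / real (2 * m)) * (\<Sum>j=m..2*m. (l2norm M (\<lambda>\<omega>. innovation_sum x j \<omega> - Z \<omega>))\<^sup>2))
      + 2 * projection_decay m"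
proof -
  have "(l2norm M (\<lambda>\<omega>. innovation_sum x m \<omega> - Z \<omega>))\<^sup>2
    \<le> 4 * ((1 / real (2 * m)) * (\<Sum>j=m..2*m. (l2norm M (\<lambda>\<omega>. innovation_sum x j \<omega> - Z \<omega>))\<^sup>2))
      + 2 * (sqrt (projection_decay m))\<^sup>2"
  proof (rule power2_le_average_plus_oscillation[OF m])
    fix j assume j: "m \<le> j" "j \<le> 2 * m"
    show "l2norm M (\<lambda>\<omega>. innovation_sum x m \<omega> - Z \<omega>)
        \<le> l2norm M (\<lambda>\<omega>. innovation_sum x j \<omega> - Z \<omega>) + sqrt (projection_decay m)"
      using innovation_sum_oscillation[OF x(1) j]
        l2norm_minus_commute[of M "innovation_sum x m" "innovation_sum x j"]
        l2norm_triangle_diff[of M "innovation_sum x m" "innovation_sum x j" Z] x(1) Z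
      by simp
  qed simp
  then show ?thesis by simp
qed

lemma average_imp_convergence:
  assumes Z: "square_integrable M Z"
    and avg: "(\<lambda>n. (1 / real n) *
      (\<Sum>j=1..n. (l2norm M (\<lambda>\<omega>. innovation_sum x j \<omega> - Z \<omega>))\<^sup>2)) \<longlonglongrightarrow> 0"
  shows "(\<lambda>m. l2norm M (\<lambda>\<omega>. innovation_sum x m \<omega> - Z \<omega>)) \<longlonglongrightarrow> 0"
proof -
  let ?e = "\<lambda>m. l2norm M (\<lambda>\<omega>. innovation_sum x m \<omega> - Z \<omega>)"
  let ?avg = "\<lambda>n. (1 / real n) * (\<Sum>j=1..n. (?e j)\<^sup>2)"
  have le: "(?e m)\<^sup>2 \<le> 4 * ?avg (2 * m) + 2 * projection_decay m" if "0 < m" for m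
  proof -
    have "(\<Sum>j=m..2*m. (?e j)\<^sup>2) \<le> (\<Sum>j=1..2*m. (?e j)\<^sup>2)"
      using that by (intro sum_mono2) auto
    then have "(1 / real (2 * m)) * (\<Sum>j=m..2*m. (?e j)\<^sup>2) \<le> ?avg (2 * m)"
      by (intro mult_left_mono) auto
    then show ?thesis using innovation_sum_distance_le[OF Z that] by linarith
  qed
  have "(\<lambda>m. ?avg (2 * m)) \<longlonglongrightarrow> 0"
    by (rule filterlim_compose[OF avg]) (simp add: filterlim_at_top_mult_tendsto_pos mult_nat_left_at_top)
  then have "(\<lambda>m. 4 * ?avg (2 * m) + 2 * projection_decay m) \<longlonglongrightarrow> 4 * 0 + 2 * 0"
    by (intro tendsto_add tendsto_mult tendsto_const projection_decay_tendsto_0)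
  then have lim0: "(\<lambda>m. 4 * ?avg (2 * m) + 2 * projection_decay m) \<longlonglongrightarrow> 0" by simp
  have "(\<lambda>m. (?e m)\<^sup>2) \<longlonglongrightarrow> 0"
    by (rule tendsto_sandwich[OF _ _ tendsto_const lim0])
      (use le in \<open>auto intro: eventually_sequentiallyI[of 1]\<close>)
  from tendsto_real_sqrt[OF this] show ?thesis by simp
qed

lemma innovation_past_measurable: "innovation f \<in> borel_measurable (past 0)"
  unfolding innovation_def[abs_def]
  using measurable_from_subalg[OF past_nested[of 0 1] borel_measurable_cond_exp]
  by (intro borel_measurable_diff borel_measurable_cond_exp) auto

lemma l2norm_innovation_le:
  assumes f: "square_integrable M f"
  shows "l2norm M (innovation f) \<le> l2norm M f"
proof (rule power2_le_imp_le)
  have "(l2norm M (innovation f))\<^sup>2 \<le> (l2norm M (E 0 f))\<^sup>2"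
    using l2norm_power2_innovation[OF f] by simp
  also have "\<dots> \<le> (l2norm M f)\<^sup>2"
    using f by (intro power_mono l2norm_cond_exp_le) simp_all
  finally show "(l2norm M (innovation f))\<^sup>2 \<le> (l2norm M f)\<^sup>2" .
qed simp

text \<open>
  Innovations are measurable with respect to \<open>\<F>\<^sub>0\<close> and orthogonal to \<open>\<F>\<^sub>-\<^sub>1\<close>, hence fixed by \<open>P\<close>.
\<close>

lemma E_innovation:
  assumes f: "square_integrable M f"
  shows "AE \<omega> in M. E 0 (innovation f) \<omega> = innovation f \<omega>"
    and "AE \<omega> in M. E 1 (innovation f) \<omega> = 0"
proof -
  show "AE \<omega> in M. E 0 (innovation f) \<omega> = innovation f \<omega>"
    using f innovation_past_measurable by (intro cond_exp_past_measurable[where m = 0]) simp_all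
  show "AE \<omega> in M. E 1 (innovation f) \<omega> = 0"
    using cond_exp_diff[OF square_integrable_E[OF f] square_integrable_E[OF f], of 1 0 1]
      cond_exp_tower[OF f zero_le_one] cond_exp_tower[OF f order_refl, of 1]
    unfolding innovation_def[abs_def] by eventually_elim simp
qed

lemma innovation_sum_eq: "AE \<omega> in M. innovation_sum x n \<omega> = innovation (birkhoff_sum n x) \<omega>"
  using innovation_birkhoff_sum[OF x(1), of n] by eventually_elim (simp add: innovation_sum_def)

text \<open>
  An \<open>L\<^sup>2\<close> limit of the series is determined only almost everywhere and need not be measurable with
  respect to \<open>\<F>\<^sub>0\<close>. Its innovation is a limit too, because \<open>P\<close> is a contraction fixing the partial
  sums, and it has the measurability demanded of the martingale difference.
\<close>

lemma innovation_sum_tendsto_innovation: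
  assumes Y: "square_integrable M Y"
    and lim: "(\<lambda>n. l2norm M (\<lambda>\<omega>. innovation_sum x n \<omega> - Y \<omega>)) \<longlonglongrightarrow> 0"
  shows "(\<lambda>n. l2norm M (\<lambda>\<omega>. innovation_sum x n \<omega> - innovation Y \<omega>)) \<longlonglongrightarrow> 0"
proof (rule tendsto_sandwich[OF _ _ tendsto_const lim]; intro always_eventually allI)
  fix n
  let ?D = "innovation_sum x n" and ?B = "birkhoff_sum n x"
  have sq: "square_integrable M ?D" "square_integrable M ?B" "square_integrable M (innovation ?B)"
    using x(1) by simp_all
  have E: "AE \<omega> in M. E k ?D \<omega> = E k (innovation ?B) \<omega>" for k
    using innovation_sum_eq[of n] sq(1,3) by (rule cond_exp_cong)
  have "AE \<omega> in M. innovation ?D \<omega> = ?D \<omega>"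
    using innovation_sum_eq[of n] E[of 0] E[of 1] E_innovation[OF sq(2)]
    by eventually_elim (simp add: innovation_def[of ?D])
  then have "AE \<omega> in M. ?D \<omega> - innovation Y \<omega> = innovation (\<lambda>\<omega>. ?D \<omega> - Y \<omega>) \<omega>"
    using innovation_diff[OF sq(1) Y] by eventually_elim simp
  then have "l2norm M (\<lambda>\<omega>. ?D \<omega> - innovation Y \<omega>) = l2norm M (innovation (\<lambda>\<omega>. ?D \<omega> - Y \<omega>))"
    using sq Y by (intro l2norm_cong_AE) simp_all
  also have "\<dots> \<le> l2norm M (\<lambda>\<omega>. ?D \<omega> - Y \<omega>)"
    using sq Y by (intro l2norm_innovation_le) simp_all
  finally show "l2norm M (\<lambda>\<omega>. ?D \<omega> - innovation Y \<omega>) \<le> l2norm M (\<lambda>\<omega>. ?D \<omega> - Y \<omega>)" .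
qed simp

lemma cond_exp_innovation_T:
  assumes f: "square_integrable M f"
  shows "AE \<omega> in M. E 0 (\<lambda>\<omega>. innovation f (T \<omega>)) \<omega> = 0"
  using cond_exp_T[OF square_integrable_innovation[OF f], of 0]
    AE_funpow[OF E_innovation(2)[OF f], of 1]
  by eventually_elim simp

lemma convergence_imp_approximation:
  assumes Y: "square_integrable M Y"
    and lim: "(\<lambda>n. l2norm M (\<lambda>\<omega>. innovation_sum x n \<omega> - Y \<omega>)) \<longlonglongrightarrow> 0"
  shows "(\<lambda>n. (1 / real n) * (l2norm M (\<lambda>\<omega>. birkhoff_sum n x (T \<omega>)
    - (\<Sum>k=1..n. innovation Y ((T ^^ k) \<omega>))))\<^sup>2) \<longlonglongrightarrow> 0"
proof -
  have "(\<lambda>n. (l2norm M (\<lambda>\<omega>. innovation_sum x n \<omega> - innovation Y \<omega>))\<^sup>2) \<longlonglongrightarrow> 0\<^sup>2"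
    by (intro tendsto_power innovation_sum_tendsto_innovation[OF assms])
  then have "(\<lambda>n. (1 / real n) *
      (\<Sum>j=1..n. (l2norm M (\<lambda>\<omega>. innovation_sum x j \<omega> - innovation Y \<omega>))\<^sup>2)) \<longlonglongrightarrow> 0"
    by (intro average_tendsto_0) simp_all
  then show ?thesis
    using approximation_iff_average[OF square_integrable_innovation[OF Y]
        innovation_past_measurable cond_exp_innovation_T[OF Y]] by blast
qed

section \<open>Autocovariances of the remote past\<close>

lemma E_birkhoff_sum:
  assumes f: "square_integrable M f"
  shows "AE \<omega> in M. E N (\<lambda>\<omega>. birkhoff_sum n f (T \<omega>)) \<omega> = (\<Sum>k=1..n. E (N + k) f ((T ^^ k) \<omega>))"
proof -
  have sq: "square_integrable M (\<lambda>\<omega>. f ((T ^^ k) \<omega>))" for k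
    by (rule square_integrable_funpow[OF f])
  have "AE \<omega> in M. \<forall>k. E N (\<lambda>\<omega>. f ((T ^^ k) \<omega>)) \<omega> = E (N + k) f ((T ^^ k) \<omega>)"
    unfolding AE_all_countable using cond_exp_funpow[OF f] by blast
  then show ?thesis
    using cond_exp_sum[of "\<lambda>k \<omega>. f ((T ^^ k) \<omega>)" N "{1..n}", OF sq]
    unfolding birkhoff_sum_T by eventually_elim simp
qed

lemma l2inner_E_right:
  assumes x: "square_integrable M x" and g: "square_integrable M g"
  shows "l2inner M x (E N g) = l2inner M (E N x) (E N g)"
  using l2inner_cond_exp_both[OF past_subalgebra x g] by simp

text \<open>
  The projection \<open>E\<^sub>N\<close> maps \<open>U\<^sup>k f\<close> to \<open>U\<^sup>k E\<^sub>N\<^sub>+\<^sub>k f\<close>. So it maps the partial sums of \<open>x\<close> and of \<open>E\<^sub>N x\<close> to the same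
  function, since \<open>E\<^sub>N\<^sub>+\<^sub>k E\<^sub>N = E\<^sub>N\<^sub>+\<^sub>k\<close>.
\<close>

lemma l2inner_truncated_birkhoff_sum:
  assumes x: "square_integrable M x"
  shows "l2inner M x (E N (\<lambda>\<omega>. birkhoff_sum n x (T \<omega>)))
    = l2inner M (E N x) (\<lambda>\<omega>. birkhoff_sum n (E N x) (T \<omega>))"
proof -
  let ?y = "E N x"
  let ?Sx = "\<lambda>\<omega>. birkhoff_sum n x (T \<omega>)"
  let ?Sy = "\<lambda>\<omega>. birkhoff_sum n ?y (T \<omega>)"
  have y: "square_integrable M ?y" using x by simp
  have Sx: "square_integrable M ?Sx" and Sy: "square_integrable M ?Sy"
    by (rule square_integrable_T square_integrable_birkhoff_sum x y)+
  have "AE \<omega> in M. E (N + k) ?y ((T ^^ k) \<omega>) = E (N + k) x ((T ^^ k) \<omega>)" for k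
    using x by (intro AE_funpow cond_exp_tower) simp_all
  then have "AE \<omega> in M. \<forall>k. E (N + k) ?y ((T ^^ k) \<omega>) = E (N + k) x ((T ^^ k) \<omega>)"
    unfolding AE_all_countable by blast
  then have "AE \<omega> in M. E N ?Sx \<omega> = E N ?Sy \<omega>"
    using E_birkhoff_sum[OF x, of N n] E_birkhoff_sum[OF y, of N n]
    by eventually_elim simp
  then have "l2inner M (E N ?Sx) ?y = l2inner M (E N ?Sy) ?y"
    using Sx Sy y by (intro l2inner_cong_AE) simp_all
  also have "\<dots> = l2inner M ?Sy ?y"
    using Sy y by (intro l2inner_cond_exp) simp_all
  finally show ?thesis
    using l2inner_E_right[OF x Sx] l2inner_cond_exp_both[OF past_subalgebra Sx x, of N]
      l2inner_cond_exp[OF past_subalgebra Sx y borel_measurable_cond_exp]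
    by (simp add: l2inner_commute)
qed

text \<open>
  The recursion is \<open>\<parallel>S\<^sub>n\<^sub>+\<^sub>1 y\<parallel>\<^sup>2 = \<parallel>y + S\<^sub>n y\<parallel>\<^sup>2\<close>, as \<open>U\<close> is an isometry.
\<close>

lemma sum_autocovariances:
  assumes y: "square_integrable M y"
  shows "(\<Sum>k=1..n. l2inner M y (\<lambda>\<omega>. birkhoff_sum (k - 1) y (T \<omega>)))
    = ((l2norm M (\<lambda>\<omega>. birkhoff_sum n y (T \<omega>)))\<^sup>2 - real n * (l2norm M y)\<^sup>2) / 2"
proof (induction n)
  case 0
  show ?case by (simp add: birkhoff_sum_def)
next
  case (Suc n)
  let ?S = "\<lambda>\<omega>. birkhoff_sum n y (T \<omega>)"
  have S: "square_integrable M ?S"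
    by (rule square_integrable_T square_integrable_birkhoff_sum y)+
  have rec: "birkhoff_sum (Suc n) y = (\<lambda>\<omega>. y \<omega> + ?S \<omega>)"
    by (simp add: fun_eq_iff birkhoff_sum_Suc)
  have "l2norm M (\<lambda>\<omega>. birkhoff_sum (Suc n) y (T \<omega>)) = l2norm M (birkhoff_sum (Suc n) y)"
    by (rule l2norm_T[OF square_integrable_birkhoff_sum[OF y]])
  then have "(l2norm M (\<lambda>\<omega>. birkhoff_sum (Suc n) y (T \<omega>)))\<^sup>2
      = (l2norm M y)\<^sup>2 + 2 * l2inner M y ?S + (l2norm M ?S)\<^sup>2"
    using l2norm_power2_add[OF y S] unfolding rec by simp
  then show ?case using Suc by (simp add: algebra_simps)
qed

definition mean_covariance :: "nat \<Rightarrow> nat \<Rightarrow> real" where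
  "mean_covariance N n
    = (1 / real n) * (\<Sum>k=1..n. l2inner M x (E N (\<lambda>\<omega>. birkhoff_sum (k - 1) x (T \<omega>))))"

text \<open>
  The martingale decomposition for \<open>E\<^sub>N x\<close>, divided by \<open>n\<close>; the remainder \<open>r\<close> comes from the part measurable
  with respect to \<open>\<F>\<^sub>0\<close>, and \<open>\<parallel>E\<^sub>N x\<parallel>\<^sup>2\<close> from the diagonal terms of the double sum of covariances.
\<close>

lemma mean_covariance_decomposition:
  assumes N: "1 \<le> N" and n: "N \<le> n"
  obtains r where
    "2 * mean_covariance N n = r + (1 / real n) *
      (\<Sum>j=N..n. (l2norm M (\<lambda>\<omega>. innovation_sum x j \<omega> - innovation_sum x N \<omega>))\<^sup>2)
      - (l2norm M (E N x))\<^sup>2"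
    "0 \<le> r" "r \<le> (1 / real n) * (\<Sum>k=1..n. l2norm M (E k x))\<^sup>2"
proof
  let ?y = "E N x"
  let ?S = "\<lambda>\<omega>. birkhoff_sum n ?y (T \<omega>)"
  let ?r = "(l2norm M (E 0 ?S))\<^sup>2"
  let ?\<Delta> = "\<lambda>j. (l2norm M (\<lambda>\<omega>. innovation_sum x j \<omega> - innovation_sum x N \<omega>))\<^sup>2"
  have y: "square_integrable M ?y" "?y \<in> borel_measurable (past 0)"
    using x(1) measurable_from_subalg[OF past_nested[of 0 N] borel_measurable_cond_exp] by simp_all
  have "(l2norm M (innovation (birkhoff_sum j ?y)))\<^sup>2 = (if N \<le> j then ?\<Delta> j else 0)" for j
  proof -
    have "l2norm M (innovation (birkhoff_sum j ?y)) = l2norm M (\<lambda>\<omega>. if N \<le> j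
        then innovation_sum x j \<omega> - innovation_sum x N \<omega> else 0)"
      using innovation_birkhoff_sum_truncated[OF x(1), of j N] x(1) y(1)
      by (intro l2norm_cong_AE) (cases "N \<le> j", simp_all)+
    then show ?thesis by simp
  qed
  then have "(\<Sum>j=1..n. (l2norm M (innovation (birkhoff_sum j ?y)))\<^sup>2)
      = (\<Sum>j=1..n. if N \<le> j then ?\<Delta> j else 0)" by simp
  also have "\<dots> = (\<Sum>j=N..n. ?\<Delta> j)"
    using N by (intro sum.mono_neutral_cong_right) auto
  finally have S: "(l2norm M ?S)\<^sup>2 = ?r + (\<Sum>j=N..n. ?\<Delta> j)"
    using martingale_decomposition[OF y, of n] by simp
  have "mean_covariance N n = (1 / real n) * (((l2norm M ?S)\<^sup>2 - real n * (l2norm M ?y)\<^sup>2) / 2)"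
    unfolding mean_covariance_def l2inner_truncated_birkhoff_sum[OF x(1)]
      sum_autocovariances[OF y(1)] ..
  then show "2 * mean_covariance N n = (1 / real n) * ?r + (1 / real n) * (\<Sum>j=N..n. ?\<Delta> j)
      - (l2norm M ?y)\<^sup>2"
    using N n unfolding S by (simp add: field_simps)
  show "0 \<le> (1 / real n) * ?r" by simp
  show "(1 / real n) * ?r \<le> (1 / real n) * (\<Sum>k=1..n. l2norm M (E k x))\<^sup>2"
    using conditional_part_le[OF y(1) l2norm_E_truncated_le[OF x(1)]]
    by (intro mult_left_mono) simp_all
qed

lemma E_power2_tendsto_0: "(\<lambda>N. (l2norm M (E N x))\<^sup>2) \<longlonglongrightarrow> 0"
  using summable_E by (rule summable_LIMSEQ_zero)

text \<open>
  The bound for \<open>n = 2 m\<close> controls the average of \<open>\<parallel>D\<^sub>j - D\<^sub>N\<parallel>\<^sup>2\<close> over \<open>m \<le> j \<le> 2 m\<close>, and slow oscillation turns this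
  into a bound for \<open>\<parallel>D\<^sub>m - D\<^sub>N\<parallel>\<^sup>2\<close>.
\<close>

lemma mean_covariance_imp_convergence:
  assumes small: "\<And>e. 0 < e \<Longrightarrow> \<exists>N0. \<forall>N\<ge>N0. \<forall>n\<ge>N. mean_covariance N n < e"
  shows "\<exists>Y. square_integrable M Y \<and> (\<lambda>n. l2norm M (\<lambda>\<omega>. innovation_sum x n \<omega> - Y \<omega>)) \<longlonglongrightarrow> 0"
proof (rule l2_complete)
  show "square_integrable M (innovation_sum x n)" for n using x(1) by simp
  fix e :: real assume e: "e > 0"
  \<comment> \<open>the final estimate is \<open>4 * (2 * \<delta> + \<delta>) + 2 * \<delta>\<close>, which is less than \<open>e\<^sup>2\<close>\<close>
  define \<delta> where "\<delta> = e\<^sup>2 / 16"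
  have \<delta>: "0 < \<delta>" using e by (simp add: \<delta>_def)
  obtain N1 where N1: "\<And>N n. N \<ge> N1 \<Longrightarrow> n \<ge> N \<Longrightarrow> mean_covariance N n < \<delta>"
    using small[OF \<delta>] by blast
  obtain N2 where N2: "\<forall>N\<ge>N2. norm ((l2norm M (E N x))\<^sup>2 - 0) < \<delta>"
    using LIMSEQ_D[OF E_power2_tendsto_0 \<delta>] by blast
  obtain N3 where N3: "\<forall>m\<ge>N3. norm (projection_decay m - 0) < \<delta>"
    using LIMSEQ_D[OF projection_decay_tendsto_0 \<delta>] by blast
  define N0 where "N0 = Max {N1, N2, N3, 1}"
  have N0: "N1 \<le> N0" "N2 \<le> N0" "N3 \<le> N0" "1 \<le> N0" by (simp_all add: N0_def)
  let ?\<Delta> = "\<lambda>N j. (l2norm M (\<lambda>\<omega>. innovation_sum x j \<omega> - innovation_sum x N \<omega>))\<^sup>2"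
  have ordered: "l2norm M (\<lambda>\<omega>. innovation_sum x m \<omega> - innovation_sum x N \<omega>) < e"
    if N: "N0 \<le> N" and m: "N \<le> m" for N m
  proof (rule power2_less_imp_less)
    have "1 \<le> N" "N \<le> 2 * m" using N0 N m by simp_all
    then obtain r where r: "2 * mean_covariance N (2 * m) = r + (1 / real (2 * m)) * (\<Sum>j=N..2*m. ?\<Delta> N j)
        - (l2norm M (E N x))\<^sup>2" "0 \<le> r"
      by (rule mean_covariance_decomposition)
    have "(1 / real (2 * m)) * (\<Sum>j=m..2*m. ?\<Delta> N j) \<le> (1 / real (2 * m)) * (\<Sum>j=N..2*m. ?\<Delta> N j)"
      using m by (intro mult_left_mono sum_mono2) auto
    also have "\<dots> \<le> 2 * mean_covariance N (2 * m) + (l2norm M (E N x))\<^sup>2"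
      using r by linarith
    also have "\<dots> < 3 * \<delta>"
    proof -
      have "mean_covariance N (2 * m) < \<delta>" using N1[of N "2 * m"] N0 N m by simp
      moreover have "norm ((l2norm M (E N x))\<^sup>2 - 0) < \<delta>" using N2 N0 N by simp
      ultimately show ?thesis by simp
    qed
    finally have avg: "(1 / real (2 * m)) * (\<Sum>j=m..2*m. ?\<Delta> N j) < 3 * \<delta>" .
    have "norm (projection_decay m - 0) < \<delta>" using N3 N0 N m by simp
    then have decay: "projection_decay m < \<delta>" by simp
    have "?\<Delta> N m \<le> 4 * ((1 / real (2 * m)) * (\<Sum>j=m..2*m. ?\<Delta> N j)) + 2 * projection_decay m"
      using x(1) N0 N m by (intro innovation_sum_distance_le) simp_all
    also have "\<dots> < 16 * \<delta>" using avg decay \<delta> by linarith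
    finally show "?\<Delta> N m < e\<^sup>2" by (simp add: \<delta>_def)
  qed (use e in simp)
  have "l2norm M (\<lambda>\<omega>. innovation_sum x m \<omega> - innovation_sum x n \<omega>) < e"
    if "m \<ge> N0" "n \<ge> N0" for m n
    using ordered[of m n] ordered[of n m] that
      l2norm_minus_commute[of M "innovation_sum x m" "innovation_sum x n"]
    by (cases "m \<le> n") simp_all
  then show "\<exists>N. \<forall>m\<ge>N. \<forall>n\<ge>N. l2norm M (\<lambda>\<omega>. innovation_sum x m \<omega> - innovation_sum x n \<omega>) < e"
    by blast
qed

lemma convergence_imp_mean_covariance:
  assumes Y: "square_integrable M Y"
    and lim: "(\<lambda>n. l2norm M (\<lambda>\<omega>. innovation_sum x n \<omega> - Y \<omega>)) \<longlonglongrightarrow> 0"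
    and e: "0 < e"
  shows "\<exists>N0. \<forall>N\<ge>N0. \<forall>n\<ge>N. \<bar>mean_covariance N n\<bar> \<le> e"
proof -
  define \<delta> where "\<delta> = min (sqrt e / 2) e"
  have \<delta>: "0 < \<delta>" "\<delta> \<le> e" "(2 * \<delta>)\<^sup>2 \<le> e"
  proof -
    show "0 < \<delta>" "\<delta> \<le> e" using e by (simp_all add: \<delta>_def)
    have "(2 * \<delta>)\<^sup>2 \<le> (sqrt e)\<^sup>2"
      using \<open>0 < \<delta>\<close> by (intro power_mono) (auto simp: \<delta>_def)
    then show "(2 * \<delta>)\<^sup>2 \<le> e" using e by simp
  qed
  obtain N1 where N1: "\<forall>n\<ge>N1. norm (l2norm M (\<lambda>\<omega>. innovation_sum x n \<omega> - Y \<omega>) - 0) < \<delta>"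
    using LIMSEQ_D[OF lim \<delta>(1)] by blast
  obtain N2 where N2: "\<forall>N\<ge>N2. norm ((l2norm M (E N x))\<^sup>2 - 0) < e"
    using LIMSEQ_D[OF E_power2_tendsto_0 e] by blast
  obtain N3 where N3: "\<forall>n\<ge>N3. norm ((1 / real n) * (\<Sum>k=1..n. l2norm M (E k x))\<^sup>2 - 0) < e"
    using LIMSEQ_D[OF conditional_part_tendsto_0 e] by blast
  define N0 where "N0 = Max {N1, N2, N3, 1}"
  have N0: "N1 \<le> N0" "N2 \<le> N0" "N3 \<le> N0" "1 \<le> N0" by (simp_all add: N0_def)
  have "\<bar>mean_covariance N n\<bar> \<le> e" if N: "N0 \<le> N" and n: "N \<le> n" for N n
  proof -
    let ?\<Delta> = "\<lambda>j. (l2norm M (\<lambda>\<omega>. innovation_sum x j \<omega> - innovation_sum x N \<omega>))\<^sup>2"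
    have n1: "1 \<le> n" and N1': "1 \<le> N" using N0 N n by simp_all
    from N1' n obtain r where r: "2 * mean_covariance N n = r + (1 / real n) * (\<Sum>j=N..n. ?\<Delta> j)
        - (l2norm M (E N x))\<^sup>2" "0 \<le> r" "r \<le> (1 / real n) * (\<Sum>k=1..n. l2norm M (E k x))\<^sup>2"
      by (rule mean_covariance_decomposition)
    have "?\<Delta> j \<le> e" if "N \<le> j" for j
    proof -
      have "norm (l2norm M (\<lambda>\<omega>. innovation_sum x j \<omega> - Y \<omega>) - 0) < \<delta>"
        "norm (l2norm M (\<lambda>\<omega>. innovation_sum x N \<omega> - Y \<omega>) - 0) < \<delta>"
        using N1 N0 N that by simp_all
      then have "l2norm M (\<lambda>\<omega>. innovation_sum x j \<omega> - innovation_sum x N \<omega>) \<le> 2 * \<delta>"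
        using l2norm_triangle_diff[of M "innovation_sum x j" Y "innovation_sum x N"] x(1) Y
          l2norm_minus_commute[of M Y "innovation_sum x N"] by simp
      then have "?\<Delta> j \<le> (2 * \<delta>)\<^sup>2" by (intro power_mono) simp_all
      then show ?thesis using \<delta>(3) by simp
    qed
    then have "(\<Sum>j=N..n. ?\<Delta> j) \<le> (\<Sum>j=N..n. e)" by (intro sum_mono) auto
    also have "\<dots> \<le> (\<Sum>j=1..n. e)" using N1' e by (intro sum_mono2) auto
    finally have "(1 / real n) * (\<Sum>j=N..n. ?\<Delta> j) \<le> (1 / real n) * (real n * e)"
      by (intro mult_left_mono) simp_all
    then have "(1 / real n) * (\<Sum>j=N..n. ?\<Delta> j) \<le> e" using n1 by simp
    moreover have "0 \<le> (1 / real n) * (\<Sum>j=N..n. ?\<Delta> j)"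
      by (intro mult_nonneg_nonneg sum_nonneg) simp_all
    moreover have "norm ((l2norm M (E N x))\<^sup>2 - 0) < e" using N2 N0 N by simp
    then have "(l2norm M (E N x))\<^sup>2 < e" by simp
    moreover have "norm ((1 / real n) * (\<Sum>k=1..n. l2norm M (E k x))\<^sup>2 - 0) < e"
      using N3 N0 N n by simp
    then have "r < e" using r(3) by (simp del: of_nat_Suc)
    moreover have "0 \<le> (l2norm M (E N x))\<^sup>2" by simp
    ultimately show ?thesis using r(1,2) unfolding abs_le_iff by linarith
  qed
  then show ?thesis by blast
qed

end

section \<open>Equivalence of the three conditions\<close>

theorem proposition2p1:
  fixes M F0 :: "'a measure" and T :: "'a \<Rightarrow> 'a" and X0 :: "'a \<Rightarrow> real"
  assumes "prob_space M"
    and "bimeasurable_preserving M T"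
    and "subalgebra M F0"
    and "sets F0 \<subseteq> sets (filt M T F0 1)"
    and "X0 \<in> borel_measurable F0"
    and "square_integrable M X0"
    and "(\<integral>\<omega>. X0 \<omega> \<partial>M) = 0"
    and "summable (\<lambda>k::nat. (l2norm M (real_cond_exp M F0 (X_seq M T X0 (int k))))\<^sup>2)"
  shows "(L2_MA M T F0 X0 \<longleftrightarrow> (\<exists>Y. L2_sums M (\<lambda>k. P0 M T F0 (X_seq M T X0 (int k))) Y))
    \<and> ((\<exists>Y. L2_sums M (\<lambda>k. P0 M T F0 (X_seq M T X0 (int k))) Y) \<longleftrightarrow>
        ((\<lambda>N::nat. SUP n\<in>{N..}. ereal ((1 / real n) * (\<Sum>k=1..n.
            (\<integral>\<omega>. X0 \<omega> * real_cond_exp M (filt M T F0 (- int N)) (S_sum M T X0 (k - 1)) \<omega> \<partial>M))))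
          \<longlonglongrightarrow> 0))
    \<and> (\<forall>D. L2_MA_with M T F0 X0 D \<longrightarrow> L2_sums M (\<lambda>k. P0 M T F0 (X_seq M T X0 (int k))) D)"
proof -
  interpret filtered_dynamics M T F0
    using assms(1-4) by (simp add: filtered_dynamics_def filtered_dynamics_axioms_def)
  have X_seq: "X_seq M T X0 (int k) = (\<lambda>\<omega>. X0 ((T ^^ k) \<omega>))" for k
    by (simp add: X_seq_def int_iter_def)
  have S_sum: "S_sum M T X0 n = (\<lambda>\<omega>. birkhoff_sum n X0 (T \<omega>))" for n
    by (simp add: S_sum_def X_seq birkhoff_sum_T)
  have P0: "P0 M T F0 f = innovation f" for f
    by (simp add: fun_eq_iff P0_def innovation_def E_0[symmetric] past_def)
  have F0_meas: "f \<in> borel_measurable F0 \<longleftrightarrow> f \<in> borel_measurable (past 0)" for f :: "'a \<Rightarrow> real"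
    by (rule measurable_cong_sets[THEN set_eq_iff[THEN iffD1, rule_format]])
      (simp_all add: sets_past_0)
  interpret summable_projections M T F0 X0
  proof
    show "square_integrable M X0" by (rule assms(6))
    show "X0 \<in> borel_measurable (past 0)" using assms(5) by (simp add: F0_meas)
    show "summable (\<lambda>k. (l2norm M (E k X0))\<^sup>2)"
      using assms(8) unfolding X_seq E_0[symmetric] l2norm_E_funpow[OF assms(6)] by simp
  qed
  define converges where "converges Y \<longleftrightarrow> square_integrable M Y \<and>
    (\<lambda>n. l2norm M (\<lambda>\<omega>. innovation_sum X0 n \<omega> - Y \<omega>)) \<longlonglongrightarrow> 0" for Y
  have sums: "L2_sums M (\<lambda>k. P0 M T F0 (X_seq M T X0 (int k))) Y \<longleftrightarrow> converges Y" for Y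
    using square_integrable_innovation[OF square_integrable_funpow[OF x(1)]]
    by (simp add: L2_sums_def P0 X_seq converges_def innovation_sum_def)
  have MA: "L2_MA_with M T F0 X0 D \<longleftrightarrow>
      D \<in> borel_measurable (past 0) \<and> square_integrable M D \<and>
      (AE \<omega> in M. E 0 (\<lambda>\<omega>. D (T \<omega>)) \<omega> = 0) \<and>
      (\<lambda>n. (1 / real n) * (l2norm M (\<lambda>\<omega>. birkhoff_sum n X0 (T \<omega>)
        - (\<Sum>k=1..n. D ((T ^^ k) \<omega>))))\<^sup>2) \<longlonglongrightarrow> 0" for D
    unfolding L2_MA_with_def S_sum E_0 F0_meas ..
  have MA_imp: "converges D" if "L2_MA_with M T F0 X0 D" for D
    using that approximation_iff_average[of D] average_imp_convergence[of D]
    unfolding MA converges_def by blast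
  have imp_MA: "L2_MA_with M T F0 X0 (innovation Y)" if "converges Y" for Y
    using that convergence_imp_approximation[of Y] cond_exp_innovation_T[of Y]
      innovation_past_measurable[of Y] square_integrable_innovation[of Y]
    unfolding MA converges_def by blast
  have cov: "(1 / real n) * (\<Sum>k=1..n. (\<integral>\<omega>. X0 \<omega> *
      real_cond_exp M (filt M T F0 (- int N)) (S_sum M T X0 (k - 1)) \<omega> \<partial>M)) = mean_covariance N n"
    for N n
    by (simp add: mean_covariance_def l2inner_def S_sum past_def)
  have "(\<exists>Y. converges Y) \<longleftrightarrow> (\<lambda>N. SUP n\<in>{N..}. ereal (mean_covariance N n)) \<longlonglongrightarrow> 0"
  proof
    assume "\<exists>Y. converges Y"
    then obtain Y where "converges Y" ..
    then show "(\<lambda>N. SUP n\<in>{N..}. ereal (mean_covariance N n)) \<longlonglongrightarrow> 0"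
      unfolding converges_def by (intro SUP_ereal_tendsto_0 convergence_imp_mean_covariance) auto
  next
    assume "(\<lambda>N. SUP n\<in>{N..}. ereal (mean_covariance N n)) \<longlonglongrightarrow> 0"
    then show "\<exists>Y. converges Y"
      unfolding converges_def
      by (intro mean_covariance_imp_convergence SUP_ereal_tendsto_0_imp)
  qed
  then show ?thesis
    unfolding sums cov L2_MA_def using MA_imp imp_MA by blast
qed

end
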